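(* Consider the one-dimensional vectorial Deffuant model with $F$ issues and confidence threshold $\theta$, where $F = \theta + 1$, started from the uniform product measure, i.e. the initial opinions $\eta_0(x)$, $x \in \mathbb{Z}$, are independent and uniformly distributed on $\{0,1\}^F$. Then the system clusters: $\lim_{t \to \infty} P(\eta_t(x) = \eta_t(y)) = 1$ for all $x, y \in \mathbb{Z}$.
   Context: $F \geq 2$ and $\theta \geq 1$ are integers. The opinion set is $\Gamma = \{0,1\}^F$ with Hamming distance $H(u,v) = \#\{i : u_i \neq v_i\}$. The vectorial Deffuant model on $\mathbb{Z}$ is the continuous-time Markov process $(\eta_t)_{t \geq 0}$, $\eta_t : \mathbb{Z} \to \Gamma$, with the following dynamics: independently at rate one, each vertex $x$ chooses one of its two nearest neighbors $y \in \{x-1,x+1\}$ uniformly at random; if $1 \leq H(\eta(x),\eta(y)) \leq \theta$, an issue $i$ is chosen uniformly at random among those with $\eta(x)_i \neq \eta(y)_i$ and the $i$-th coordinate of $\eta(x)$ is set equal to $\eta(y)_i$ (all else unchanged); otherwise nothing happens. (Equivalently, the opinion at $x$ is replaced by a uniformly chosen $u \in \Gamma$ with $H(u,\eta(y)) = H(\eta(x),\eta(y)) - 1$.) *)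

theory Defs
  imports "HOL-Probability.Probability"
begin

text \<open>Opinions in {0,1}^F are encoded as subsets of {..<F} (the set of issues
  with value 1). A configuration is a map int => nat set.\<close>

definition hamming :: "nat set \<Rightarrow> nat set \<Rightarrow> nat" where
  "hamming u v = card ((u - v) \<union> (v - u))"

definition flip_issue :: "nat \<Rightarrow> nat set \<Rightarrow> nat set" where
  "flip_issue i u = (if i \<in> u then u - {i} else insert i u)"

definition local_fun :: "int set \<Rightarrow> ((int \<Rightarrow> nat set) \<Rightarrow> real) \<Rightarrow> bool" where
  "local_fun L f \<longleftrightarrow> finite L \<and> (\<forall>\<eta> \<eta>'. (\<forall>x\<in>L. \<eta> x = \<eta>' x) \<longrightarrow> f \<eta> = f \<eta>')"

text \<open>Generator of the vectorial Deffuant model applied to a function f depending only on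
  the sites in L (sites outside L do not contribute). Vertex x at rate 1 picks neighbour y
  with probability 1/2; if 1 <= H <= theta, a uniformly chosen disagreeing issue of x is
  set to the value of y (i.e. flipped).\<close>
definition deffuant_gen ::
  "nat \<Rightarrow> int set \<Rightarrow> ((int \<Rightarrow> nat set) \<Rightarrow> real) \<Rightarrow> (int \<Rightarrow> nat set) \<Rightarrow> real" where
  "deffuant_gen \<theta> L f \<eta> =
     (\<Sum>x\<in>L. \<Sum>y\<in>{x - 1, x + 1}. (1/2) *
        (if 1 \<le> hamming (\<eta> x) (\<eta> y) \<and> hamming (\<eta> x) (\<eta> y) \<le> \<theta>
         then (1 / real (hamming (\<eta> x) (\<eta> y))) *
              (\<Sum>i\<in>(\<eta> x - \<eta> y) \<union> (\<eta> y - \<eta> x). f (\<eta>(x := flip_issue i (\<eta> x))) - f \<eta>)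
         else 0))"

definition nat_filt :: "'a measure \<Rightarrow> (real \<Rightarrow> int \<Rightarrow> 'a \<Rightarrow> nat set) \<Rightarrow> real \<Rightarrow> 'a measure" where
  "nat_filt M \<eta> s = sigma (space M) {\<eta> r x -` B \<inter> space M | r x B. 0 \<le> r \<and> r \<le> s}"

text \<open>eta is (a cadlag version of) the vectorial Deffuant model on Z with F issues and
  threshold theta, on the probability space M, i.e. a solution of the martingale problem
  for the generator above.\<close>
definition deffuant_process ::
  "nat \<Rightarrow> nat \<Rightarrow> 'a measure \<Rightarrow> (real \<Rightarrow> int \<Rightarrow> 'a \<Rightarrow> nat set) \<Rightarrow> bool" where
  "deffuant_process F \<theta> M \<eta> \<longleftrightarrow>
     prob_space M \<and>
     (\<forall>t x. \<eta> t x \<in> measurable M (count_space UNIV)) \<and>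
     (\<forall>t x. \<forall>\<omega>\<in>space M. \<eta> t x \<omega> \<subseteq> {..<F}) \<and>
     \<comment> \<open>cadlag paths (in the discrete topology on opinions)\<close>
     (\<forall>\<omega>\<in>space M. \<forall>x t. 0 \<le> t \<longrightarrow>
        (\<exists>\<epsilon>>0. \<forall>r. t \<le> r \<and> r < t + \<epsilon> \<longrightarrow> \<eta> r x \<omega> = \<eta> t x \<omega>)) \<and>
     (\<forall>\<omega>\<in>space M. \<forall>x t. 0 < t \<longrightarrow>
        (\<exists>\<epsilon>>0. \<exists>v. \<forall>r. t - \<epsilon> < r \<and> r < t \<longrightarrow> \<eta> r x \<omega> = v)) \<and>
     \<comment> \<open>martingale problem for all local test functions\<close>
     (\<forall>L f s t. local_fun L f \<longrightarrow> 0 \<le> s \<longrightarrow> s \<le> t \<longrightarrow>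
        (\<forall>A\<in>sets (nat_filt M \<eta> s).
           (LINT \<omega>:A|M. f (\<lambda>x. \<eta> t x \<omega>) - f (\<lambda>x. \<eta> s x \<omega>)
               - (LBINT r=s..t. deffuant_gen \<theta> L f (\<lambda>x. \<eta> r x \<omega>))) = 0))"

definition uniform_product_init ::
  "nat \<Rightarrow> 'a measure \<Rightarrow> (real \<Rightarrow> int \<Rightarrow> 'a \<Rightarrow> nat set) \<Rightarrow> bool" where
  "uniform_product_init F M \<eta> \<longleftrightarrow>
     (\<forall>S u. finite S \<longrightarrow> (\<forall>x\<in>S. u x \<subseteq> {..<F}) \<longrightarrow>
        measure M {\<omega>\<in>space M. \<forall>x\<in>S. \<eta> 0 x \<omega> = u x} = (1 / 2 ^ F) ^ card S)"

end

theory Submission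
  imports Defs
begin

text \<open>Put on the edge between x and x + 1 one particle for each issue on which the two opinions differ.
  Particles on edges with at most \<theta> particles (active edges) hop, two particles of the same issue on one
  edge annihilate, and edges with all F = \<theta> + 1 particles (full edges) are frozen until a particle hops onto
  them and annihilates. Only expectations of local functions at a single time are used. They solve the linear
  hierarchy given by the generator, and a Taylor expansion shows that its solution is determined by the initial law;
  hence the law stays translation invariant, and flipping one issue to the right of a far away site changes it only
  slightly.

  The mean number of particles per edge decreases at the rate of annihilations, so this rate tends to 0
  (its derivative is bounded), and by the same argument so does the probability of every local configuration
  from which an annihilation can be reached. A window with an active edge and more than F particles is
  such a configuration, so a window typically has at most F particles or no active edge;
  letting the window grow shows that the probability of an active edge tends to 0.

  If the particle density did not vanish, full edges would persist with positive density. The flip makes two far away full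
  edges carry different pairs of opposite opinions with positive probability, and they are destroyed only by
  annihilations, which are rare at late times. But between two full edges of different type there is always an active edge:
  a contradiction.\<close>

section \<open>Jumps, generator and local functions\<close>

definition active :: "nat \<Rightarrow> nat set \<Rightarrow> nat set \<Rightarrow> bool" where
  "active \<theta> u v \<longleftrightarrow> 1 \<le> hamming u v \<and> hamming u v \<le> \<theta>"

text \<open>Half the mean of \<open>h\<close> after \<open>x\<close> imitates \<open>y\<close> on a
  random disagreeing issue, and 0 on inactive edges. Not subtracting \<open>h \<zeta>\<close> keeps
  it monotone and linear in \<open>h\<close>; the summands of the generator are the case
  \<open>\<lambda>\<xi>. f \<xi> - f \<zeta>\<close>.\<close>

definition jump ::
  "nat \<Rightarrow> (int \<Rightarrow> nat set) \<Rightarrow> int \<Rightarrow> int \<Rightarrow> ((int \<Rightarrow> nat set) \<Rightarrow> real) \<Rightarrow> real" where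
  "jump \<theta> \<zeta> x y h = (1/2) *
     (if active \<theta> (\<zeta> x) (\<zeta> y)
      then (1 / real (hamming (\<zeta> x) (\<zeta> y))) *
           (\<Sum>i\<in>sym_diff (\<zeta> x) (\<zeta> y). h (\<zeta>(x := flip_issue i (\<zeta> x))))
      else 0)"

definition configs :: "nat \<Rightarrow> (int \<Rightarrow> nat set) set" where
  "configs F = {\<zeta>. \<forall>x. \<zeta> x \<subseteq> {..<F}}"

lemma hamming_commute: "hamming u v = hamming v u"
  by (simp add: hamming_def Un_commute)

lemma active_commute: "active \<theta> u v \<longleftrightarrow> active \<theta> v u"
  by (simp add: active_def hamming_commute)

lemma hamming_self [simp]: "hamming u u = 0"
  by (simp add: hamming_def)

lemma finite_sym_diff_active: "active \<theta> u v \<Longrightarrow> finite (sym_diff u v)"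
  by (rule card_ge_0_finite) (simp add: active_def hamming_def)

lemma deffuant_gen_jump:
  "deffuant_gen \<theta> L f \<zeta> = (\<Sum>x\<in>L. \<Sum>y\<in>{x - 1, x + 1}. jump \<theta> \<zeta> x y (\<lambda>\<xi>. f \<xi> - f \<zeta>))"
  by (simp add: deffuant_gen_def jump_def active_def)

lemma deffuant_gen_jump':
  "deffuant_gen \<theta> L f \<zeta> =
     (\<Sum>x\<in>L. jump \<theta> \<zeta> x (x - 1) (\<lambda>\<xi>. f \<xi> - f \<zeta>) + jump \<theta> \<zeta> x (x + 1) (\<lambda>\<xi>. f \<xi> - f \<zeta>))"
  by (simp add: deffuant_gen_jump)

lemma jump_zero: "jump \<theta> \<zeta> x y (\<lambda>_. 0) = 0"
  by (simp add: jump_def)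

lemma jump_const: "jump \<theta> \<zeta> x y (\<lambda>_. c) = (1/2) * (if active \<theta> (\<zeta> x) (\<zeta> y) then c else 0)"
  by (auto simp: jump_def hamming_def active_def)

lemma jump_diff: "jump \<theta> \<zeta> x y (\<lambda>\<xi>. f \<xi> - g \<xi>) = jump \<theta> \<zeta> x y f - jump \<theta> \<zeta> x y g"
  by (simp add: jump_def sum_subtractf right_diff_distrib diff_divide_distrib)

lemma jump_mono:
  assumes "\<And>i. active \<theta> (\<zeta> x) (\<zeta> y) \<Longrightarrow> i \<in> sym_diff (\<zeta> x) (\<zeta> y) \<Longrightarrow>
      h (\<zeta>(x := flip_issue i (\<zeta> x))) \<le> h' (\<zeta>(x := flip_issue i (\<zeta> x)))"
  shows "jump \<theta> \<zeta> x y h \<le> jump \<theta> \<zeta> x y h'"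
proof (cases "active \<theta> (\<zeta> x) (\<zeta> y)")
  case True
  have "(\<Sum>i\<in>sym_diff (\<zeta> x) (\<zeta> y). h (\<zeta>(x := flip_issue i (\<zeta> x)))) \<le>
        (\<Sum>i\<in>sym_diff (\<zeta> x) (\<zeta> y). h' (\<zeta>(x := flip_issue i (\<zeta> x))))"
    by (rule sum_mono) (rule assms[OF True])
  thus ?thesis by (simp add: jump_def divide_right_mono)
qed (simp add: jump_def)

text \<open>A given disagreeing issue is chosen with probability 1/H, where H is at most \<theta>,
  and the rate contributes 1/2; so the nonnegative sum keeps at least a share 1/(2\<theta>) of each
  single term.\<close>

lemma jump_single:
  assumes "active \<theta> (\<zeta> x) (\<zeta> y)" "i \<in> sym_diff (\<zeta> x) (\<zeta> y)" "\<And>\<xi>. 0 \<le> h \<xi>"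
  shows "h (\<zeta>(x := flip_issue i (\<zeta> x))) \<le> 2 * real \<theta> * jump \<theta> \<zeta> x y h"
proof -
  let ?H = "real (hamming (\<zeta> x) (\<zeta> y))"
  let ?s = "\<Sum>i\<in>sym_diff (\<zeta> x) (\<zeta> y). h (\<zeta>(x := flip_issue i (\<zeta> x)))"
  have "h (\<zeta>(x := flip_issue i (\<zeta> x))) \<le> ?s"
    by (rule member_le_sum) (use assms finite_sym_diff_active in auto)
  moreover have "0 \<le> ?s"
    using assms(3) by (auto intro: sum_nonneg)
  moreover have "1 \<le> ?H" "?H \<le> real \<theta>"
    using assms(1) by (auto simp: active_def)
  moreover have "2 * real \<theta> * jump \<theta> \<zeta> x y h = (real \<theta> / ?H) * ?s"
    using assms(1) by (simp add: jump_def)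
  moreover have "1 * ?s \<le> (real \<theta> / ?H) * ?s"
    by (rule mult_right_mono) (use calculation in auto)
  ultimately show ?thesis by simp
qed

lemma abs_jump_le:
  assumes "\<And>i. i \<in> sym_diff (\<zeta> x) (\<zeta> y) \<Longrightarrow> \<bar>h (\<zeta>(x := flip_issue i (\<zeta> x)))\<bar> \<le> B" "0 \<le> B"
  shows "\<bar>jump \<theta> \<zeta> x y h\<bar> \<le> B / 2"
proof -
  have "jump \<theta> \<zeta> x y h \<le> jump \<theta> \<zeta> x y (\<lambda>_. B)"
    by (rule jump_mono) (use assms abs_le_iff in blast)
  moreover have "jump \<theta> \<zeta> x y (\<lambda>_. - B) \<le> jump \<theta> \<zeta> x y h"
  proof (rule jump_mono)
    fix i assume "i \<in> sym_diff (\<zeta> x) (\<zeta> y)"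
    from assms(1)[OF this] show "- B \<le> h (\<zeta>(x := flip_issue i (\<zeta> x)))" by linarith
  qed
  ultimately show ?thesis
    using assms(2) by (simp add: jump_const split: if_splits)
qed

lemma configs_flip:
  assumes "\<zeta> \<in> configs F" "i \<in> sym_diff (\<zeta> x) (\<zeta> y)"
  shows "\<zeta>(x := flip_issue i (\<zeta> x)) \<in> configs F"
  using assms unfolding configs_def flip_issue_def by (auto; blast)

lemma configs_finite: "\<zeta> \<in> configs F \<Longrightarrow> finite (\<zeta> x)"
  using finite_subset by (fastforce simp: configs_def)

lemma configs_sym_diff: "\<zeta> \<in> configs F \<Longrightarrow> sym_diff (\<zeta> x) (\<zeta> y) \<subseteq> {..<F}"
  by (auto simp: configs_def)

lemma local_fun_mono: "local_fun S f \<Longrightarrow> S \<subseteq> S' \<Longrightarrow> finite S' \<Longrightarrow> local_fun S' f"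
  unfolding local_fun_def by blast

lemma local_funD: "local_fun S f \<Longrightarrow> (\<And>x. x \<in> S \<Longrightarrow> \<zeta> x = \<zeta>' x) \<Longrightarrow> f \<zeta> = f \<zeta>'"
  unfolding local_fun_def by blast

lemma local_fun_finite: "local_fun S f \<Longrightarrow> finite S"
  unfolding local_fun_def by blast

lemma local_funI:
  assumes "finite S" "\<And>\<zeta> \<zeta>'. (\<And>x. x \<in> S \<Longrightarrow> \<zeta> x = \<zeta>' x) \<Longrightarrow> f \<zeta> = f \<zeta>'"
  shows "local_fun S f"
  unfolding local_fun_def
proof (intro conjI allI impI)
  fix \<zeta> \<zeta>' :: "int \<Rightarrow> nat set" assume "\<forall>x\<in>S. \<zeta> x = \<zeta>' x"
  thus "f \<zeta> = f \<zeta>'" by (intro assms(2)) (rule bspec)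
qed (rule assms(1))

lemma local_fun_jump:
  assumes "local_fun S f" "S \<subseteq> S'" "finite S'" "x \<in> S'" "y \<in> S'"
  shows "local_fun S' (\<lambda>\<zeta>. jump \<theta> \<zeta> x y (\<lambda>\<xi>. f \<xi> - f \<zeta>))"
  unfolding local_fun_def
proof (intro conjI allI impI)
  show "finite S'" by fact
  fix \<zeta> \<zeta>' :: "int \<Rightarrow> nat set" assume eq: "\<forall>z\<in>S'. \<zeta> z = \<zeta>' z"
  have x: "\<zeta> x = \<zeta>' x" and y: "\<zeta> y = \<zeta>' y"
    using eq assms(4,5) by blast+
  have 1: "f (\<zeta>(x := v)) = f (\<zeta>'(x := v))" for v
    by (rule local_funD[OF assms(1)]) (use eq assms(2) in auto)
  have 2: "f \<zeta> = f \<zeta>'"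
    by (rule local_funD[OF assms(1)]) (use eq assms(2) in auto)
  show "jump \<theta> \<zeta> x y (\<lambda>\<xi>. f \<xi> - f \<zeta>) = jump \<theta> \<zeta>' x y (\<lambda>\<xi>. f \<xi> - f \<zeta>')"
    unfolding jump_def x y 1 2 by (rule refl)
qed

lemma local_fun_sum:
  assumes "finite S" "\<And>k. k \<in> K \<Longrightarrow> local_fun S (f k)"
  shows "local_fun S (\<lambda>\<zeta>. \<Sum>k\<in>K. f k \<zeta>)"
proof (rule local_funI[OF assms(1)])
  fix \<zeta> \<zeta>' :: "int \<Rightarrow> nat set" assume eq: "\<And>z. z \<in> S \<Longrightarrow> \<zeta> z = \<zeta>' z"
  show "(\<Sum>k\<in>K. f k \<zeta>) = (\<Sum>k\<in>K. f k \<zeta>')"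
    by (rule sum.cong[OF refl]) (rule local_funD[OF assms(2) eq])
qed

lemma local_fun_comp2:
  assumes "local_fun S f" "local_fun S' g" "S \<union> S' \<subseteq> T" "finite T"
  shows "local_fun T (\<lambda>\<zeta>. comb (f \<zeta>) (g \<zeta>))"
proof (rule local_funI[OF assms(4)])
  fix \<zeta> \<zeta>' :: "int \<Rightarrow> nat set" assume eq: "\<And>z. z \<in> T \<Longrightarrow> \<zeta> z = \<zeta>' z"
  have "f \<zeta> = f \<zeta>'" "g \<zeta> = g \<zeta>'"
    using assms(3) eq by (auto intro: local_funD[OF assms(1)] local_funD[OF assms(2)])
  thus "comb (f \<zeta>) (g \<zeta>) = comb (f \<zeta>') (g \<zeta>')" by simp
qed

lemma local_fun_comp: "local_fun S f \<Longrightarrow> local_fun S (\<lambda>\<zeta>. g (f \<zeta>))"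
  unfolding local_fun_def by metis

lemma local_fun_gen:
  assumes "local_fun S f" "finite S'" "\<And>x. x \<in> S \<Longrightarrow> {x - 1, x, x + 1} \<subseteq> S'"
  shows "local_fun S' (deffuant_gen \<theta> S f)"
  unfolding deffuant_gen_jump
  by (intro local_fun_sum local_fun_jump[OF assms(1)]) (use assms in auto)

text \<open>Each site has two jumps of rate at most 1/2, and each jump changes \<open>f\<close> by
  at most \<open>2 * B\<close>.\<close>

lemma gen_bound:
  assumes "\<And>\<xi>. \<xi> \<in> configs F \<Longrightarrow> \<bar>f \<xi>\<bar> \<le> B" "\<zeta> \<in> configs F"
  shows "\<bar>deffuant_gen \<theta> S f \<zeta>\<bar> \<le> 2 * real (card S) * B"
proof -
  have B: "0 \<le> B" using assms(1)[OF assms(2)] by linarith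
  have J: "\<bar>jump \<theta> \<zeta> x y (\<lambda>\<xi>. f \<xi> - f \<zeta>)\<bar> \<le> (2 * B) / 2" for x y
  proof (rule abs_jump_le)
    fix i assume "i \<in> sym_diff (\<zeta> x) (\<zeta> y)"
    from configs_flip[OF assms(2) this]
    have "\<bar>f (\<zeta>(x := flip_issue i (\<zeta> x)))\<bar> \<le> B" by (rule assms(1))
    with assms(1)[OF assms(2)]
    show "\<bar>f (\<zeta>(x := flip_issue i (\<zeta> x))) - f \<zeta>\<bar> \<le> 2 * B" by linarith
  qed (use B in simp)
  have "\<bar>deffuant_gen \<theta> S f \<zeta>\<bar> \<le> (\<Sum>x\<in>S. 2 * B)"
    unfolding deffuant_gen_jump'
  proof (rule order_trans[OF sum_abs sum_mono])
    fix x
    show "\<bar>jump \<theta> \<zeta> x (x - 1) (\<lambda>\<xi>. f \<xi> - f \<zeta>) + jump \<theta> \<zeta> x (x + 1) (\<lambda>\<xi>. f \<xi> - f \<zeta>)\<bar> \<le> 2 * B"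
      using J[of x "x - 1"] J[of x "x + 1"] by linarith
  qed
  thus ?thesis by simp
qed

text \<open>The elements of PiE are undefined outside S, which a function local on S does not see.\<close>

lemma local_fun_expand:
  assumes "local_fun S f" "\<zeta> \<in> configs F"
  shows "f \<zeta> = (\<Sum>c\<in>PiE S (\<lambda>_. Pow {..<F}). f c * of_bool (\<forall>x\<in>S. \<zeta> x = c x))"
proof -
  note fin = local_fun_finite[OF assms(1)]
  let ?r = "restrict \<zeta> S" and ?P = "PiE S (\<lambda>_. Pow {..<F})"
  have r: "?r \<in> ?P" using assms(2) by (auto simp: configs_def)
  have "(\<forall>x\<in>S. \<zeta> x = c x) \<longleftrightarrow> c = ?r" if "c \<in> ?P" for c
  proof
    assume *: "\<forall>x\<in>S. \<zeta> x = c x"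
    show "c = ?r" by (rule PiE_ext[OF that r]) (use * in auto)
  qed auto
  hence "(\<Sum>c\<in>?P. f c * of_bool (\<forall>x\<in>S. \<zeta> x = c x)) = (\<Sum>c\<in>?P. if c = ?r then f c else 0)"
    by (intro sum.cong) auto
  also have "\<dots> = f ?r"
    using r fin by (simp add: finite_PiE)
  also have "\<dots> = f \<zeta>"
    by (rule local_funD[OF assms(1)]) simp
  finally show ?thesis by simp
qed

text \<open>With opinions inside \<open>{..<F}\<close> a finite window has only finitely many
  states; the sum of the absolute values over them is a crude bound.\<close>

lemma local_fun_bounded:
  assumes "local_fun S f"
  obtains B where "0 \<le> B" "\<And>\<zeta>. \<zeta> \<in> configs F \<Longrightarrow> \<bar>f \<zeta>\<bar> \<le> B"
proof
  let ?P = "PiE S (\<lambda>_. Pow {..<F})"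
  show "0 \<le> (\<Sum>c\<in>?P. \<bar>f c\<bar>)" by (simp add: sum_nonneg)
  fix \<zeta> assume "\<zeta> \<in> configs F"
  from local_fun_expand[OF assms this]
  have "\<bar>f \<zeta>\<bar> = \<bar>\<Sum>c\<in>?P. f c * of_bool (\<forall>x\<in>S. \<zeta> x = c x)\<bar>" by simp
  also have "\<dots> \<le> (\<Sum>c\<in>?P. \<bar>f c\<bar>)"
    by (rule order_trans[OF sum_abs sum_mono]) (auto simp: abs_mult)
  finally show "\<bar>f \<zeta>\<bar> \<le> (\<Sum>c\<in>?P. \<bar>f c\<bar>)" .
qed

section \<open>Laws of the process\<close>

locale deffuant =
  fixes F \<theta> :: nat and M :: "'a measure" and \<eta> :: "real \<Rightarrow> int \<Rightarrow> 'a \<Rightarrow> nat set"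
  assumes threshold_pos: "1 \<le> \<theta>" and issues_eq: "F = \<theta> + 1"
    and process: "deffuant_process F \<theta> M \<eta>"
    and init: "uniform_product_init F M \<eta>"
begin

sublocale prob_space M
  using process by (simp add: deffuant_process_def)

abbreviation gen :: "int set \<Rightarrow> ((int \<Rightarrow> nat set) \<Rightarrow> real) \<Rightarrow> (int \<Rightarrow> nat set) \<Rightarrow> real" where
  "gen \<equiv> deffuant_gen \<theta>"

definition conf :: "real \<Rightarrow> 'a \<Rightarrow> int \<Rightarrow> nat set" where
  "conf t \<omega> = (\<lambda>x. \<eta> t x \<omega>)"

definition law :: "real \<Rightarrow> ((int \<Rightarrow> nat set) \<Rightarrow> real) \<Rightarrow> real" where
  "law t f = (\<integral>\<omega>. f (conf t \<omega>) \<partial>M)"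

lemma conf_configs [simp]: "\<omega> \<in> space M \<Longrightarrow> conf t \<omega> \<in> configs F"
  using process by (simp add: deffuant_process_def configs_def conf_def)

lemma measurable_opinion: "\<eta> t x \<in> measurable M (count_space UNIV)"
  using process by (simp add: deffuant_process_def)

lemma sets_cylinder:
  assumes "finite S"
  shows "{\<omega>\<in>space M. \<forall>x\<in>S. \<eta> t x \<omega> = c x} \<in> sets M"
proof -
  have "{\<omega>\<in>space M. \<eta> t x \<omega> = c x} \<in> sets M" for x
    using measurable_sets[OF measurable_opinion, of "{c x}" t x]
    by (simp add: vimage_def Int_def conj_commute)
  thus ?thesis using assms by (intro sets.sets_Collect_finite_All) auto
qed

lemma measurable_local [measurable]:
  assumes "local_fun S f"
  shows "(\<lambda>\<omega>. f (conf t \<omega>)) \<in> borel_measurable M"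
proof -
  have "(\<lambda>\<omega>. \<Sum>c\<in>PiE S (\<lambda>_. Pow {..<F}). f c *
      indicator {\<omega>\<in>space M. \<forall>x\<in>S. \<eta> t x \<omega> = c x} \<omega>) \<in> borel_measurable M"
    using sets_cylinder[OF local_fun_finite[OF assms]] by measurable
  moreover have "f (conf t \<omega>) = (\<Sum>c\<in>PiE S (\<lambda>_. Pow {..<F}). f c *
      indicator {\<omega>\<in>space M. \<forall>x\<in>S. \<eta> t x \<omega> = c x} \<omega>)" if "\<omega> \<in> space M" for \<omega>
    using local_fun_expand[OF assms conf_configs[OF that], of t] that
    by (simp add: indicator_def of_bool_def conf_def)
  ultimately show ?thesis
    by (subst measurable_cong) auto
qed

lemma integrable_local:
  assumes "local_fun S f"
  shows "integrable M (\<lambda>\<omega>. f (conf t \<omega>))"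
proof -
  obtain B where "\<And>\<zeta>. \<zeta> \<in> configs F \<Longrightarrow> \<bar>f \<zeta>\<bar> \<le> B"
    using local_fun_bounded[OF assms] by metis
  thus ?thesis
    by (intro integrable_const_bound[where B = B] measurable_local[OF assms] AE_I2) auto
qed

lemma law_bound:
  assumes "\<And>\<zeta>. \<zeta> \<in> configs F \<Longrightarrow> \<bar>f \<zeta>\<bar> \<le> B" "0 \<le> B"
  shows "\<bar>law t f\<bar> \<le> B"
proof (cases "integrable M (\<lambda>\<omega>. f (conf t \<omega>))")
  case True
  have "\<bar>law t f\<bar> \<le> (\<integral>\<omega>. \<bar>f (conf t \<omega>)\<bar> \<partial>M)"
    unfolding law_def by (rule integral_abs_bound)
  also have "\<dots> \<le> (\<integral>\<omega>. B \<partial>M)"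
    using True by (intro integral_mono) (auto intro: assms)
  finally show ?thesis by (simp add: prob_space)
next
  \<comment> \<open>A function that is not integrable has Bochner integral 0 by convention.\<close>
  case False
  thus ?thesis by (simp add: law_def not_integrable_integral_eq assms)
qed

lemma law_cong: "(\<And>\<zeta>. \<zeta> \<in> configs F \<Longrightarrow> f \<zeta> = g \<zeta>) \<Longrightarrow> law t f = law t g"
  unfolding law_def by (rule Bochner_Integration.integral_cong) auto

lemma law_mono:
  assumes "local_fun S f" "local_fun S' g" "\<And>\<zeta>. \<zeta> \<in> configs F \<Longrightarrow> f \<zeta> \<le> g \<zeta>"
  shows "law t f \<le> law t g"
  unfolding law_def
  by (rule integral_mono) (auto intro: integrable_local assms)

lemma law_const: "law t (\<lambda>_. c) = c"
  by (simp add: law_def prob_space)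

lemma law_add:
  "local_fun S f \<Longrightarrow> local_fun S' g \<Longrightarrow> law t (\<lambda>\<zeta>. f \<zeta> + g \<zeta>) = law t f + law t g"
  by (simp add: law_def integrable_local)

lemma law_cmult: "law t (\<lambda>\<zeta>. c * f \<zeta>) = c * law t f"
  by (simp add: law_def)

lemma law_minus: "law t (\<lambda>\<zeta>. - f \<zeta>) = - law t f"
  by (simp add: law_def)

lemma law_sum:
  assumes "\<And>k. k \<in> K \<Longrightarrow> \<exists>S. local_fun S (f k)"
  shows "law t (\<lambda>\<zeta>. \<Sum>k\<in>K. f k \<zeta>) = (\<Sum>k\<in>K. law t (f k))"
  unfolding law_def
proof (rule Bochner_Integration.integral_sum)
  show "integrable M (\<lambda>\<omega>. f k (conf t \<omega>))" if "k \<in> K" for k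
    using assms[OF that] integrable_local by blast
qed

lemma law_nonneg: "(\<And>\<zeta>. \<zeta> \<in> configs F \<Longrightarrow> 0 \<le> f \<zeta>) \<Longrightarrow> 0 \<le> law t f"
  unfolding law_def by (rule integral_nonneg_AE) (auto intro: AE_I2)

section \<open>From the martingale problem to an integral equation for expectations\<close>

lemma right_continuous:
  assumes "\<omega> \<in> space M" "0 \<le> t"
  obtains \<epsilon> where "\<epsilon> > 0" "\<And>r. t \<le> r \<Longrightarrow> r < t + \<epsilon> \<Longrightarrow> \<eta> r x \<omega> = \<eta> t x \<omega>"
  using process assms unfolding deffuant_process_def by meson

text \<open>The grid point lies to the right of \<open>r\<close>, as right-continuity of the paths
  demands; clipping at 0 keeps it among the times where the paths are known to be regular.\<close>

lemma grid_time:
  fixes r :: real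
  defines "v \<equiv> \<lambda>n. max 0 ((of_int \<lfloor>real (Suc n) * r\<rfloor> + 1) / real (Suc n))"
  shows "max 0 r \<le> v n" "v n \<le> max 0 r + 1 / real (Suc n)"
proof -
  let ?k = "of_int \<lfloor>real (Suc n) * r\<rfloor> :: real"
  have k: "?k \<le> r * real (Suc n)" "r * real (Suc n) \<le> ?k + 1"
    by (simp_all add: mult.commute del: of_nat_Suc)
  have "r \<le> (?k + 1) / real (Suc n)"
    using k(2) by (subst pos_le_divide_eq) auto
  thus "max 0 r \<le> v n" by (simp add: v_def)
  have "(?k + 1) / real (Suc n) \<le> r + 1 / real (Suc n)"
    using k(1) by (simp add: add_divide_distrib pos_divide_le_eq del: of_nat_Suc)
  moreover have "0 < 1 / real (Suc n)" by simp
  ultimately show "v n \<le> max 0 r + 1 / real (Suc n)"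
    unfolding v_def by linarith
qed

text \<open>Right-continuity makes the process a pointwise limit of processes read at a nearby later
  grid time; each of these is measurable because its time takes countably many values.\<close>

lemma joint_measurable:
  assumes "local_fun S f"
  shows "(\<lambda>p. f (conf (max 0 (fst p)) (snd p))) \<in> borel_measurable (lborel \<Otimes>\<^sub>M M)"
proof (rule borel_measurable_LIMSEQ_real)
  let ?v = "\<lambda>(n::nat) (k::int). max 0 ((of_int k + 1) / real (Suc n)) :: real"
  let ?X = "\<lambda>n (p :: real \<times> 'a). f (conf (?v n \<lfloor>real (Suc n) * fst p\<rfloor>) (snd p))"
  show "?X n \<in> borel_measurable (lborel \<Otimes>\<^sub>M M)" for n
  proof (rule measurable_compose_countable[where f = "\<lambda>k (p :: real \<times> 'a). f (conf (?v n k) (snd p))"])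
    fix k :: int
    show "(\<lambda>p. f (conf (?v n k) (snd p))) \<in> borel_measurable (lborel \<Otimes>\<^sub>M M)"
      using measurable_compose[OF measurable_snd measurable_local[OF assms]] .
  next
    show "(\<lambda>p. \<lfloor>real (Suc n) * fst p\<rfloor>) \<in> measurable (lborel \<Otimes>\<^sub>M M) (count_space UNIV)"
      by measurable
  qed
  fix p :: "real \<times> 'a" assume "p \<in> space (lborel \<Otimes>\<^sub>M M)"
  hence \<omega>: "snd p \<in> space M" by (auto simp: space_pair_measure)
  let ?u = "max 0 (fst p)"
  have "\<forall>\<^sub>F n in sequentially. \<eta> (?v n \<lfloor>real (Suc n) * fst p\<rfloor>) x (snd p) = \<eta> ?u x (snd p)" for x
  proof -
    obtain \<epsilon> where \<epsilon>: "\<epsilon> > 0" "\<And>r. ?u \<le> r \<Longrightarrow> r < ?u + \<epsilon> \<Longrightarrow> \<eta> r x (snd p) = \<eta> ?u x (snd p)"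
      using right_continuous[OF \<omega>, of ?u x] by auto
    have "\<forall>\<^sub>F n in sequentially. 1 / real (Suc n) < \<epsilon>"
      using order_tendstoD(2)[OF LIMSEQ_inverse_real_of_nat \<epsilon>(1)] by (simp add: inverse_eq_divide)
    thus ?thesis
    proof eventually_elim
      case (elim n)
      show ?case using grid_time[where r = "fst p" and n = n] elim by (intro \<epsilon>(2)) linarith+
    qed
  qed
  hence "\<forall>\<^sub>F n in sequentially. \<forall>x\<in>S. \<eta> (?v n \<lfloor>real (Suc n) * fst p\<rfloor>) x (snd p) = \<eta> ?u x (snd p)"
    by (intro eventually_ball_finite local_fun_finite[OF assms]) auto
  hence "\<forall>\<^sub>F n in sequentially. ?X n p = f (conf ?u (snd p))"
    by eventually_elim (rule local_funD[OF assms], simp add: conf_def)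
  thus "(\<lambda>n. ?X n p) \<longlonglongrightarrow> f (conf ?u (snd p))"
    by (rule tendsto_eventually)
qed

text \<open>The martingale identity is used with the whole space as event; boundedness of the local
  function \<open>gen S f\<close> then allows Fubini to move the expectation inside the time
  integral.\<close>

lemma law_evolution:
  assumes f: "local_fun S f" and st: "0 \<le> s" "s \<le> t"
  shows "(\<lambda>r. law (max 0 r) (gen S f)) \<in> borel_measurable lborel"
    and "law t f - law s f = (\<integral>r. indicator {s<..<t} r * law (max 0 r) (gen S f) \<partial>lborel)"
proof -
  interpret P: pair_sigma_finite lborel M
    by unfold_locales
  define S' where "S' = (\<lambda>x. x - 1) ` S \<union> S \<union> (\<lambda>x. x + 1) ` S"
  have g: "local_fun S' (gen S f)"
    by (rule local_fun_gen[OF f]) (use local_fun_finite[OF f] in \<open>auto simp: S'_def\<close>)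
  obtain B where B: "0 \<le> B" "\<And>\<zeta>. \<zeta> \<in> configs F \<Longrightarrow> \<bar>gen S f \<zeta>\<bar> \<le> B"
    using local_fun_bounded[OF g] by metis
  let ?G = "\<lambda>r \<omega>. indicator {s<..<t} r * gen S f (conf (max 0 r) \<omega>)"
  note jm [measurable] = joint_measurable[OF g]
  have jm': "(\<lambda>(r, \<omega>). gen S f (conf (max 0 r) \<omega>)) \<in> borel_measurable (lborel \<Otimes>\<^sub>M M)"
    using jm by (simp add: case_prod_beta')
  have "(\<lambda>r. \<integral>\<omega>. gen S f (conf (max 0 r) \<omega>) \<partial>M) \<in> borel_measurable lborel"
    by (rule borel_measurable_lebesgue_integral[OF jm'])
  thus "(\<lambda>r. law (max 0 r) (gen S f)) \<in> borel_measurable lborel"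
    by (simp add: law_def)
  have G: "integrable (lborel \<Otimes>\<^sub>M M) (case_prod ?G)"
  proof (rule integrableI_bounded_set[where A = "{s<..<t} \<times> space M" and B = B])
    show "{s<..<t} \<times> space M \<in> sets (lborel \<Otimes>\<^sub>M M)" by simp
    show "case_prod ?G \<in> borel_measurable (lborel \<Otimes>\<^sub>M M)"
      unfolding case_prod_beta' by measurable
    show "emeasure (lborel \<Otimes>\<^sub>M M) ({s<..<t} \<times> space M) < \<infinity>"
      using st by (subst emeasure_pair_measure_Times) (auto simp: emeasure_space_1)
    show "AE p in lborel \<Otimes>\<^sub>M M. p \<in> {s<..<t} \<times> space M \<longrightarrow> norm (case_prod ?G p) \<le> B"
      by (auto intro!: AE_I2 B(2))
    show "AE p in lborel \<Otimes>\<^sub>M M. p \<notin> {s<..<t} \<times> space M \<longrightarrow> case_prod ?G p = 0"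
      by (auto intro!: AE_I2 simp: space_pair_measure indicator_def)
  qed
  \<comment> \<open>The interval integral runs over the open interval, where \<open>r\<close> is
    positive and the clipping \<open>max 0 r\<close> has no effect.\<close>
  have I: "(LBINT r=ereal s..ereal t. gen S f (conf r \<omega>)) = (\<integral>r. ?G r \<omega> \<partial>lborel)" for \<omega>
    unfolding interval_lebesgue_integral_le_eq[OF st(2)[folded ereal_less_eq(3)]] set_lebesgue_integral_def
    using st by (intro Bochner_Integration.integral_cong) (auto simp: indicator_def max_def)
  have int: "integrable M (\<lambda>\<omega>. \<integral>r. ?G r \<omega> \<partial>lborel)"
    using P.integrable_snd[OF G] .
  have "space M \<in> sets (nat_filt M \<eta> s)"
    unfolding nat_filt_def by (metis (no_types, lifting) sets.top space_measure_of_conv)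
  hence "(LINT \<omega>:space M|M. f (\<lambda>x. \<eta> t x \<omega>) - f (\<lambda>x. \<eta> s x \<omega>)
               - (LBINT r=ereal s..ereal t. gen S f (\<lambda>x. \<eta> r x \<omega>))) = 0"
    using process f st unfolding deffuant_process_def by blast
  hence "(\<integral>\<omega>. f (conf t \<omega>) - f (conf s \<omega>) - (\<integral>r. ?G r \<omega> \<partial>lborel) \<partial>M) = 0"
    unfolding I[unfolded conf_def] conf_def
    by (simp add: set_lebesgue_integral_def cong: Bochner_Integration.integral_cong)
  hence "law t f - law s f - (\<integral>\<omega>. (\<integral>r. ?G r \<omega> \<partial>lborel) \<partial>M) = 0"
    by (simp add: law_def integrable_local[OF f] int)
  also have "(\<integral>\<omega>. (\<integral>r. ?G r \<omega> \<partial>lborel) \<partial>M) = (\<integral>r. (\<integral>\<omega>. ?G r \<omega> \<partial>M) \<partial>lborel)"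
    by (rule P.Fubini_integral[OF G])
  finally show "law t f - law s f = (\<integral>r. indicator {s<..<t} r * law (max 0 r) (gen S f) \<partial>lborel)"
    by (simp add: law_def)
qed

end

section \<open>Derivatives and uniqueness of the law\<close>

text \<open>By Taylor, \<open>v t * h\<close> differs from \<open>u (t + h) - u t\<close> by at most
  \<open>C * h\<^sup>2\<close>, and that increment becomes small because \<open>u\<close> converges.
  The step \<open>h\<close> is fixed first, small against \<open>e / C\<close>.\<close>

lemma tendsto_deriv_zero:
  fixes u v z :: "real \<Rightarrow> real"
  assumes u: "\<And>t. 0 \<le> t \<Longrightarrow> (u has_real_derivative v t) (at t within {0..})"
    and v: "\<And>t. 0 \<le> t \<Longrightarrow> (v has_real_derivative z t) (at t within {0..})"
    and z: "\<And>t. 0 \<le> t \<Longrightarrow> \<bar>z t\<bar> \<le> C"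
    and lim: "(u \<longlongrightarrow> l) at_top"
  shows "(v \<longlongrightarrow> 0) at_top"
proof (rule tendstoI)
  fix e :: real assume e: "e > 0"
  have C: "0 \<le> C" using z[of 0] by linarith
  \<comment> \<open>\<open>C + 1\<close> instead of \<open>C\<close> avoids dividing by 0.\<close>
  define h where "h = e / (2 * (C + 1))"
  have h: "h > 0" using e C by (simp add: h_def)
  have Ch: "C * h < e / 2"
    using e C by (simp add: h_def field_simps)
  have "\<forall>\<^sub>F t in at_top. dist (u t) l < e * h / 4"
    using tendstoD[OF lim, of "e * h / 4"] e h by simp
  then obtain T where T: "\<And>t. T \<le> t \<Longrightarrow> dist (u t) l < e * h / 4"
    unfolding eventually_at_top_linorder by blast
  show "\<forall>\<^sub>F t in at_top. dist (v t) 0 < e"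
  proof (rule eventually_at_top_linorderI)
    fix t assume t: "max 0 T \<le> t"
    define D where "D i = (if i = 0 then u else if i = Suc 0 then v else z)" for i :: nat
    have "norm (D 0 (t + h) - (\<Sum>i\<le>1. D i t * (t + h - t) ^ i / fact i))
          \<le> C * norm (t + h - t) ^ Suc 1 / fact 1"
      by (rule field_Taylor[where S = "{0..}"]) (use t h u v z in \<open>auto simp: D_def le_Suc_eq\<close>)
    hence "\<bar>u (t + h) - (u t + v t * h)\<bar> \<le> C * h\<^sup>2"
      by (simp add: D_def power2_eq_square)
    moreover have "\<bar>u (t + h) - l\<bar> < e * h / 4" "\<bar>u t - l\<bar> < e * h / 4"
      using T[of "t + h"] T[of t] t h by (auto simp: dist_real_def)
    ultimately have "\<bar>v t * h\<bar> < e * h / 2 + (C * h) * h"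
      unfolding power2_eq_square by argo
    also have "\<dots> \<le> e * h / 2 + (e / 2) * h"
      using Ch h by (intro add_left_mono mult_right_mono) auto
    finally have "\<bar>v t\<bar> * h < e * h"
      using h by (simp add: abs_mult)
    thus "dist (v t) 0 < e" using h by simp
  qed
qed

text \<open>\<open>P\<close> will hold one or two base points, possibly far apart: the size is
  controlled by \<open>card P\<close> and the radius, whatever the distance between the
  points.\<close>

definition nbhd :: "int set \<Rightarrow> nat \<Rightarrow> int set" where
  "nbhd P w = (\<Union>p\<in>P. {p - int w..p + int w})"

lemma finite_nbhd [simp]: "finite P \<Longrightarrow> finite (nbhd P w)"
  by (simp add: nbhd_def)

lemma card_nbhd: "finite P \<Longrightarrow> card (nbhd P w) \<le> card P * (2 * w + 1)"
  unfolding nbhd_def by (rule card_UN_le[THEN order_trans]) (auto simp: nat_add_distrib nat_mult_distrib)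

context deffuant
begin

lemma law_lipschitz:
  assumes f: "local_fun S f" and B: "\<And>\<zeta>. \<zeta> \<in> configs F \<Longrightarrow> \<bar>gen S f \<zeta>\<bar> \<le> B" "0 \<le> B"
    and "0 \<le> s" "s \<le> t"
  shows "\<bar>law t f - law s f\<bar> \<le> B * (t - s)"
proof -
  note m [measurable] = law_evolution(1)[OF f assms(4,5)]
  have "\<bar>law t f - law s f\<bar> \<le> (\<integral>r. \<bar>indicator {s<..<t} r * law (max 0 r) (gen S f)\<bar> \<partial>lborel)"
    unfolding law_evolution(2)[OF f assms(4,5)] by (rule integral_abs_bound)
  also have "\<dots> \<le> (\<integral>r. indicator {s<..<t} r * B \<partial>lborel)"
  proof (rule integral_mono')
    show "integrable lborel (\<lambda>r. indicator {s<..<t} r * B)"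
      using assms by (intro integrable_mult_left) (simp add: integrable_real_indicator)
  qed (auto simp: indicator_def intro: law_bound B)
  also have "\<dots> = B * (t - s)" using assms by simp
  finally show ?thesis .
qed

lemma gen_local_bounded:
  assumes "local_fun S f"
  obtains S' B where "local_fun S' (gen S f)" "0 \<le> B" "\<And>\<zeta>. \<zeta> \<in> configs F \<Longrightarrow> \<bar>gen S f \<zeta>\<bar> \<le> B"
proof -
  have "local_fun ((\<lambda>x. x - 1) ` S \<union> S \<union> (\<lambda>x. x + 1) ` S) (gen S f)"
    by (rule local_fun_gen[OF assms]) (use local_fun_finite[OF assms] in auto)
  with local_fun_bounded[OF this] that show ?thesis by metis
qed

lemma continuous_on_law:
  assumes "local_fun S f"
  shows "continuous_on {0..} (\<lambda>t. law t f)"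
proof -
  obtain B where B: "0 \<le> B" "\<And>\<zeta>. \<zeta> \<in> configs F \<Longrightarrow> \<bar>gen S f \<zeta>\<bar> \<le> B"
    using gen_local_bounded[OF assms] by metis
  have "B-lipschitz_on {0..} (\<lambda>t. law t f)"
  proof (rule lipschitz_onI)
    fix s t :: real assume st: "s \<in> {0..}" "t \<in> {0..}"
    have "\<bar>law t f - law s f\<bar> \<le> B * \<bar>t - s\<bar>"
      using law_lipschitz[OF assms B(2,1), of s t] law_lipschitz[OF assms B(2,1), of t s] st
      by (cases "s \<le> t") (auto simp: abs_minus_commute)
    thus "dist (law s f) (law t f) \<le> B * dist s t"
      by (simp add: dist_real_def abs_minus_commute)
  qed (rule B)
  thus ?thesis by (rule lipschitz_on_continuous_on)
qed

text \<open>\<open>gen S f\<close> is again local, so its expectation is continuous in time and the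
  integral equation can be differentiated by the fundamental theorem of calculus. The derivative is
  one-sided at 0.\<close>

lemma law_has_derivative:
  assumes f: "local_fun S f" and t: "0 \<le> t"
  shows "((\<lambda>t. law t f) has_real_derivative law t (gen S f)) (at t within {0..})"
proof -
  obtain S' where g: "local_fun S' (gen S f)" using gen_local_bounded[OF f] by metis
  have cont: "continuous_on {0..b} (\<lambda>r. law r (gen S f))" for b
    by (rule continuous_on_subset[OF continuous_on_law[OF g]]) auto
  have eq: "law b f = law 0 f + integral {0..b} (\<lambda>r. law r (gen S f))" if "0 \<le> b" for b
  proof -
    have si: "set_integrable lborel {0<..<b} (\<lambda>r. law r (gen S f))"
      by (rule set_integrable_subset[OF borel_integrable_atLeastAtMost'[OF cont[of b]]]) auto
    have "law b f - law 0 f = (LINT r:{0<..<b}|lborel. law r (gen S f))"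
      unfolding law_evolution(2)[OF f order_refl that] set_lebesgue_integral_def
      by (rule Bochner_Integration.integral_cong) (auto simp: indicator_def max_def)
    also have "\<dots> = integral {0<..<b} (\<lambda>r. law r (gen S f))"
      using set_borel_integral_eq_integral(2)[OF si] .
    also have "\<dots> = integral {0..b} (\<lambda>r. law r (gen S f))"
      by (rule integral_open_interval_real[symmetric])
    finally show ?thesis by simp
  qed
  have "((\<lambda>b. integral {0..b} (\<lambda>r. law r (gen S f))) has_real_derivative law t (gen S f))
      (at t within {0..t + 1})"
    by (rule integral_has_real_derivative[OF cont]) (use t in auto)
  also have "at t within {0..t + 1} = at t within {0..}"
    by (rule at_within_nhd[of t "{..<t + 1}"]) (use t in auto)
  finally have "((\<lambda>b. law 0 f + integral {0..b} (\<lambda>r. law r (gen S f))) has_real_derivative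
      law t (gen S f)) (at t within {0..})"
    by (auto intro!: derivative_eq_intros)
  thus ?thesis
  proof (rule has_field_derivative_transform_within[where d = 1])
    show "law 0 f + integral {0..b} (\<lambda>r. law r (gen S f)) = law b f" if "b \<in> {0..}" for b
      by (rule eq[symmetric]) (use that in simp)
  qed (use t in auto)
qed

text \<open>The second derivative is the expectation of the generator applied twice, a bounded local
  function, so \<open>tendsto_deriv_zero\<close> applies.\<close>

lemma law_gen_tendsto_zero:
  assumes f: "local_fun S f" and lim: "((\<lambda>t. law t f) \<longlongrightarrow> l) at_top"
  shows "((\<lambda>t. law t (gen S f)) \<longlongrightarrow> 0) at_top"
proof -
  obtain S' where g: "local_fun S' (gen S f)" using gen_local_bounded[OF f] by metis
  obtain B where B: "0 \<le> B" "\<And>\<zeta>. \<zeta> \<in> configs F \<Longrightarrow> \<bar>gen S' (gen S f) \<zeta>\<bar> \<le> B"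
    using gen_local_bounded[OF g] by metis
  show ?thesis
    by (rule tendsto_deriv_zero[OF law_has_derivative[OF f] law_has_derivative[OF g] law_bound lim])
      (use B in auto)
qed

section \<open>Taylor expansion in time and approximate invariance under symmetries\<close>

primrec gen_iter :: "int set \<Rightarrow> nat \<Rightarrow> ((int \<Rightarrow> nat set) \<Rightarrow> real) \<Rightarrow> nat \<Rightarrow> (int \<Rightarrow> nat set) \<Rightarrow> real" where
  "gen_iter P w f 0 = f"
| "gen_iter P w f (Suc j) = gen (nbhd P (w + j)) (gen_iter P w f j)"

text \<open>The generator also reads the neighbours of its window, so each application widens the
  radius by one.\<close>

lemma local_fun_gen_iter:
  assumes "local_fun (nbhd P w) f" "finite P"
  shows "local_fun (nbhd P (w + j)) (gen_iter P w f j)"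
proof (induction j)
  case (Suc j)
  show ?case unfolding gen_iter.simps
  proof (rule local_fun_gen[OF Suc])
    fix x assume "x \<in> nbhd P (w + j)"
    then obtain p where "p \<in> P" "p - int (w + j) \<le> x" "x \<le> p + int (w + j)"
      by (auto simp: nbhd_def)
    thus "{x - 1, x, x + 1} \<subseteq> nbhd P (w + Suc j)"
      unfolding nbhd_def by (auto intro!: bexI[of _ p])
  qed (simp add: assms(2))
qed (simp add: assms)

text \<open>For two base points the window of radius \<open>w + j\<close> has at most
  \<open>2 * (2 * (w + j) + 1)\<close> sites, so one more generator costs a factor of at most
  \<open>8 * (w + j + 1)\<close>. The product is \<open>8 ^ j * fact (w + j) / fact w\<close>, and
  bounding a binomial coefficient by \<open>2 ^ (w + j)\<close> separates the dependence on
  \<open>w\<close> from \<open>16 ^ j * fact j\<close>.\<close>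

lemma gen_iter_bound:
  assumes f: "local_fun (nbhd P w) f" "finite P" "card P \<le> 2"
    and B: "\<And>\<zeta>. \<zeta> \<in> configs F \<Longrightarrow> \<bar>f \<zeta>\<bar> \<le> B" and "\<zeta> \<in> configs F"
  shows "\<bar>gen_iter P w f j \<zeta>\<bar> \<le> B * 2 ^ w * 16 ^ j * fact j"
proof -
  have B0: "0 \<le> B" using B[OF assms(5)] by linarith
  have 1: "\<zeta> \<in> configs F \<Longrightarrow> \<bar>gen_iter P w f j \<zeta>\<bar> \<le> B * 8 ^ j * (fact (w + j) / fact w)" for \<zeta>
  proof (induction j arbitrary: \<zeta>)
    case (Suc j)
    let ?b = "B * 8 ^ j * (fact (w + j) / fact w)"
    have "card (nbhd P (w + j)) \<le> 2 * (2 * (w + j) + 1)"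
      using card_nbhd[OF f(2), of "w + j"] mult_le_mono1[OF f(3), of "2 * (w + j) + 1"] by linarith
    hence "real (card (nbhd P (w + j))) \<le> real (2 * (2 * (w + j) + 1))"
      by (simp only: of_nat_le_iff)
    hence "2 * real (card (nbhd P (w + j))) \<le> 8 * (real (w + j) + 1)"
      by simp
    hence "2 * real (card (nbhd P (w + j))) * ?b \<le> (8 * (real (w + j) + 1)) * ?b"
      by (rule mult_right_mono) (use B0 in simp)
    also have "\<dots> = B * 8 ^ Suc j * (fact (w + Suc j) / fact w)"
      by (simp add: field_simps)
    finally show ?case
      using gen_bound[where f = "gen_iter P w f j" and B = ?b and S = "nbhd P (w + j)", OF Suc.IH Suc.prems]
      by (auto intro: order_trans)
  qed (use B in simp)
  have "real (w + j choose w) \<le> 2 ^ (w + j)"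
    using binomial_le_pow2[of "w + j" w] by (metis of_nat_le_iff of_nat_numeral of_nat_power)
  hence "fact (w + j) / fact w \<le> 2 ^ (w + j) * (fact j :: real)"
    by (simp add: binomial_fact field_simps)
  hence "B * 8 ^ j * (fact (w + j) / fact w) \<le> B * 8 ^ j * (2 ^ (w + j) * fact j)"
    by (intro mult_left_mono) (use B0 in auto)
  also have "\<dots> = B * 2 ^ w * (8 * 2) ^ j * fact j"
    by (simp only: power_add power_mult_distrib mult_ac)
  finally show ?thesis using 1[OF assms(5)] by simp
qed

text \<open>The bound m limits how often the generator may be applied before \<sigma> ceases to commute with it.\<close>

definition symmetry :: "int set \<Rightarrow> nat \<Rightarrow> ((int \<Rightarrow> nat set) \<Rightarrow> int \<Rightarrow> nat set) \<Rightarrow> bool" where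
  "symmetry P m \<sigma> \<longleftrightarrow>
     (\<forall>\<zeta>\<in>configs F. \<sigma> \<zeta> \<in> configs F) \<and>
     (\<forall>S h. local_fun S h \<longrightarrow> law 0 (h \<circ> \<sigma>) = law 0 h) \<and>
     (\<forall>w<m. \<forall>h. local_fun (nbhd P w) h \<longrightarrow>
        (\<exists>S. local_fun S (h \<circ> \<sigma>) \<and> gen S (h \<circ> \<sigma>) = gen (nbhd P w) h \<circ> \<sigma>))"

text \<open>\<open>m\<close> is chosen before \<open>P\<close>, \<open>\<sigma>\<close> and
  \<open>h\<close>, so that one distance serves all pairs of sites; scaling by \<open>B\<close> lets
  the bound be applied to iterated generators, whose size grows.\<close>

definition asymptotically_invariant :: "real \<Rightarrow> bool" where
  "asymptotically_invariant t \<longleftrightarrow> (\<forall>w. \<forall>\<epsilon>>0. \<exists>m. \<forall>P \<sigma> h B.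
     finite P \<longrightarrow> card P \<le> 2 \<longrightarrow> symmetry P m \<sigma> \<longrightarrow> local_fun (nbhd P w) h \<longrightarrow>
     (\<forall>\<zeta>\<in>configs F. \<bar>h \<zeta>\<bar> \<le> B) \<longrightarrow> \<bar>law t (h \<circ> \<sigma>) - law t h\<bar> \<le> \<epsilon> * B)"

lemma symmetry_mono: "symmetry P m \<sigma> \<Longrightarrow> m' \<le> m \<Longrightarrow> symmetry P m' \<sigma>"
  unfolding symmetry_def by (meson order_less_le_trans)

lemma configs_empty: "(\<lambda>_. {}) \<in> configs F"
  by (simp add: configs_def)

text \<open>The k-th derivatives grow like 16^k k!, so Taylor's formula determines the law on a time
  interval whose length does not depend on the test function.\<close>

lemma asymptotically_invariant_step:
  assumes inv: "asymptotically_invariant s" and s: "0 \<le> s" and r: "0 \<le> r" "r \<le> 1 / 64"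
  shows "asymptotically_invariant (s + r)"
  unfolding asymptotically_invariant_def
proof (intro allI impI)
  fix w :: nat and \<epsilon> :: real assume \<epsilon>: "\<epsilon> > 0"
  \<comment> \<open>With \<open>r \<le> 1 / 64\<close> the Taylor remainder will be at most
    \<open>B * (2 * 2 ^ w * (1 / 2) ^ Suc n)\<close>; \<open>n\<close> is taken so large that this
    is at most \<open>B * (\<epsilon> / 2)\<close>.\<close>
  have lim: "(\<lambda>n. (2 * 2 ^ w) * (1 / 2) ^ n :: real) \<longlonglongrightarrow> (2 * 2 ^ w) * 0"
    by (intro tendsto_intros LIMSEQ_power_zero) auto
  have "\<forall>\<^sub>F n in sequentially. 2 * 2 ^ w * (1 / 2) ^ n < \<epsilon> / 2"
    using order_tendstoD(2)[OF lim, of "\<epsilon> / 2"] \<epsilon> by simp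
  then obtain n where "\<And>k. n \<le> k \<Longrightarrow> 2 * 2 ^ w * (1 / 2) ^ k < \<epsilon> / 2"
    by (auto simp: eventually_sequentially)
  from less_imp_le[OF this[of "Suc n"]]
  have n: "2 * 2 ^ w * (1 / 2) ^ Suc n \<le> \<epsilon> / 2" by simp
  \<comment> \<open>The Taylor terms will sum to at most \<open>\<epsilon>' * B * 2 ^ w * 2\<close>,
    which this value makes equal to \<open>B * (\<epsilon> / 2)\<close>.\<close>
  define \<epsilon>' where "\<epsilon>' = \<epsilon> / (4 * 2 ^ w)"
  have "\<epsilon>' > 0" using \<epsilon> by (simp add: \<epsilon>'_def)
  hence "\<forall>j. \<exists>m. \<forall>P \<sigma> h B.
     finite P \<longrightarrow> card P \<le> 2 \<longrightarrow> symmetry P m \<sigma> \<longrightarrow> local_fun (nbhd P (w + j)) h \<longrightarrow>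
     (\<forall>\<zeta>\<in>configs F. \<bar>h \<zeta>\<bar> \<le> B) \<longrightarrow> \<bar>law s (h \<circ> \<sigma>) - law s h\<bar> \<le> \<epsilon>' * B"
    using inv unfolding asymptotically_invariant_def by blast
  then obtain m where m: "\<And>j P \<sigma> h B.
     finite P \<Longrightarrow> card P \<le> 2 \<Longrightarrow> symmetry P (m j) \<sigma> \<Longrightarrow> local_fun (nbhd P (w + j)) h \<Longrightarrow>
     (\<forall>\<zeta>\<in>configs F. \<bar>h \<zeta>\<bar> \<le> B) \<Longrightarrow> \<bar>law s (h \<circ> \<sigma>) - law s h\<bar> \<le> \<epsilon>' * B"
    by metis
  show "\<exists>m. \<forall>P \<sigma> h B.
     finite P \<longrightarrow> card P \<le> 2 \<longrightarrow> symmetry P m \<sigma> \<longrightarrow> local_fun (nbhd P w) h \<longrightarrow>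
     (\<forall>\<zeta>\<in>configs F. \<bar>h \<zeta>\<bar> \<le> B) \<longrightarrow> \<bar>law (s + r) (h \<circ> \<sigma>) - law (s + r) h\<bar> \<le> \<epsilon> * B"
  \<comment> \<open>The sum is at least every \<open>m j\<close> that is needed, and
    \<open>w + n + 1\<close> lets \<open>\<sigma>\<close> commute with the generators of radius up
    to \<open>w + n\<close>.\<close>
  proof (intro exI[of _ "(\<Sum>j\<le>n. m j) + w + n + 1"] allI impI)
    fix P \<sigma> h B
    assume P: "finite P" "card P \<le> 2" and \<sigma>: "symmetry P ((\<Sum>j\<le>n. m j) + w + n + 1) \<sigma>"
      and h: "local_fun (nbhd P w) h" and B: "\<forall>\<zeta>\<in>configs F. \<bar>h \<zeta>\<bar> \<le> B"
    have B0: "0 \<le> B" using B configs_empty by force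
    note loc = local_fun_gen_iter[OF h P(1)]
    have bd: "\<bar>gen_iter P w h i \<zeta>\<bar> \<le> B * 2 ^ w * 16 ^ i * fact i" if "\<zeta> \<in> configs F" for i \<zeta>
      by (rule gen_iter_bound[OF h P]) (use B that in auto)
    define u where "u i t = law t (gen_iter P w h i \<circ> \<sigma>) - law t (gen_iter P w h i)" for i t
    define K where "K = 2 * (B * 2 ^ w * 16 ^ Suc n * fact (Suc n))"
    have taylor: "norm (u 0 (s + r) - (\<Sum>i\<le>n. u i s * (s + r - s) ^ i / fact i))
        \<le> K * norm (s + r - s) ^ Suc n / fact n"
    proof (rule field_Taylor[where S = "{0..}"])
      fix i and t :: real assume t: "t \<in> {0..}" and i: "i \<le> n"
      have "w + i < (\<Sum>j\<le>n. m j) + w + n + 1" using i by linarith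
      then obtain S where S: "local_fun S (gen_iter P w h i \<circ> \<sigma>)"
        "gen S (gen_iter P w h i \<circ> \<sigma>) = gen_iter P w h (Suc i) \<circ> \<sigma>"
        using \<sigma> loc[of i] unfolding symmetry_def gen_iter.simps by blast
      show "(u i has_field_derivative u (Suc i) t) (at t within {0..})"
        unfolding u_def
        using law_has_derivative[OF S(1), of t] law_has_derivative[OF loc, of t i] t
        by (intro DERIV_diff) (auto simp: S(2))
    next
      fix t :: real
      have "\<bar>law t (gen_iter P w h (Suc n) \<circ> \<sigma>)\<bar> \<le> K / 2"
      proof (rule law_bound)
        fix \<zeta> assume "\<zeta> \<in> configs F"
        hence "\<sigma> \<zeta> \<in> configs F" using \<sigma> by (auto simp: symmetry_def)
        from bd[OF this, of "Suc n"] show "\<bar>(gen_iter P w h (Suc n) \<circ> \<sigma>) \<zeta>\<bar> \<le> K / 2"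
          by (simp add: K_def mult_ac del: gen_iter.simps)
      qed (use B0 in \<open>simp add: K_def\<close>)
      moreover have "\<bar>law t (gen_iter P w h (Suc n))\<bar> \<le> K / 2"
        using bd[of _ "Suc n"] B0
        by (intro law_bound) (auto simp: K_def mult_ac simp del: gen_iter.simps)
      ultimately show "norm (u (Suc n) t) \<le> K"
        unfolding u_def by simp
    qed (use s r in auto)
    have r16: "0 \<le> 16 * r" "16 * r \<le> 1 / 4" using r by auto
    have "K * norm (s + r - s) ^ Suc n / fact n = (2 * B * 2 ^ w) * ((16 * r) ^ Suc n * real (Suc n))"
      using r by (simp add: K_def power_mult_distrib)
    \<comment> \<open>The factor \<open>Suc n\<close> left over from
      \<open>fact (Suc n) / fact n\<close> is absorbed by \<open>2 ^ Suc n\<close>.\<close>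
    also have "\<dots> \<le> (2 * B * 2 ^ w) * ((1 / 4) ^ Suc n * 2 ^ Suc n)"
    proof (intro mult_left_mono mult_mono power_mono r16)
      show "real (Suc n) \<le> 2 ^ Suc n" by (rule less_imp_le[OF of_nat_less_two_power])
    qed (use B0 r in auto)
    also have "\<dots> = B * (2 * 2 ^ w * (1 / 2) ^ Suc n)"
      by (simp flip: power_mult_distrib)
    also have "\<dots> \<le> B * (\<epsilon> / 2)"
      by (rule mult_left_mono[OF n B0])
    finally have rem: "K * norm (s + r - s) ^ Suc n / fact n \<le> B * (\<epsilon> / 2)" .
    have "\<bar>\<Sum>i\<le>n. u i s * (s + r - s) ^ i / fact i\<bar> \<le> (\<Sum>i\<le>n. \<epsilon>' * B * 2 ^ w * (1 / 4) ^ i)"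
    proof (rule order_trans[OF sum_abs sum_mono])
      fix i assume "i \<in> {..n}"
      hence "m i \<le> (\<Sum>j\<le>n. m j)" by (intro member_le_sum) auto
      hence "symmetry P (m i) \<sigma>" by (intro symmetry_mono[OF \<sigma>]) linarith
      \<comment> \<open>Invariance at time \<open>s\<close> is applied to the \<open>i\<close>-th
        iterated generator with its own bound; the factorial cancels against the Taylor
        coefficient.\<close>
      hence "\<bar>u i s\<bar> \<le> \<epsilon>' * (B * 2 ^ w * 16 ^ i * fact i)"
        unfolding u_def by (rule m[OF P _ loc]) (use bd in auto)
      hence "\<bar>u i s\<bar> * (r ^ i / fact i) \<le> \<epsilon>' * (B * 2 ^ w * 16 ^ i * fact i) * (r ^ i / fact i)"
        by (rule mult_right_mono) (use r in auto)
      also have "\<dots> = \<epsilon>' * B * 2 ^ w * (16 * r) ^ i"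
        by (simp add: power_mult_distrib)
      also have "\<dots> \<le> \<epsilon>' * B * 2 ^ w * (1 / 4) ^ i"
        by (intro mult_left_mono power_mono r16) (use B0 \<open>\<epsilon>' > 0\<close> in auto)
      finally show "\<bar>u i s * (s + r - s) ^ i / fact i\<bar> \<le> \<epsilon>' * B * 2 ^ w * (1 / 4) ^ i"
        using r by (simp add: abs_mult)
    qed
    also have "\<dots> = (\<epsilon>' * B * 2 ^ w) * (\<Sum>i\<le>n. (1 / 4) ^ i)"
      by (simp add: sum_distrib_left)
    also have "\<dots> \<le> (\<epsilon>' * B * 2 ^ w) * 2"
    proof (rule mult_left_mono)
      have "(\<Sum>i\<le>n. (1 / 4) ^ i :: real) = (1 - (1 / 4) ^ Suc n) / (1 - 1 / 4)"
        using sum_gp0[of "1 / 4 :: real" n] by simp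
      also have "\<dots> \<le> 1 / (1 - 1 / 4)" by (rule divide_right_mono) auto
      finally show "(\<Sum>i\<le>n. (1 / 4) ^ i :: real) \<le> 2" by simp
    qed (use B0 \<open>\<epsilon>' > 0\<close> in auto)
    also have "\<dots> = B * (\<epsilon> / 2)" by (simp add: \<epsilon>'_def)
    finally have "\<bar>u 0 (s + r)\<bar> \<le> B * (\<epsilon> / 2) + B * (\<epsilon> / 2)"
      using taylor rem unfolding real_norm_def by linarith
    thus "\<bar>law (s + r) (h \<circ> \<sigma>) - law (s + r) h\<bar> \<le> \<epsilon> * B"
      by (simp add: u_def algebra_simps)
  qed
qed

text \<open>The step length \<open>1 / 64\<close> is the same for all test functions, so finitely
  many steps and a shorter last one reach \<open>t\<close> from time 0, where symmetries preserve
  the law exactly.\<close>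

lemma asymptotically_invariant:
  assumes "0 \<le> t"
  shows "asymptotically_invariant t"
proof -
  have grid: "asymptotically_invariant (real k * (1 / 64))" for k
  proof (induction k)
    case 0
    show ?case unfolding asymptotically_invariant_def
    proof (intro allI impI exI[of _ 0])
      fix w and \<epsilon> :: real and P \<sigma> h and B :: real
      assume *: "0 < \<epsilon>" "symmetry P 0 \<sigma>" "local_fun (nbhd P w) h" "\<forall>\<zeta>\<in>configs F. \<bar>h \<zeta>\<bar> \<le> B"
      have "0 \<le> B" using *(4) configs_empty by force
      moreover have "law 0 (h \<circ> \<sigma>) = law 0 h" using *(2,3) by (auto simp: symmetry_def)
      ultimately show "\<bar>law (real 0 * (1 / 64)) (h \<circ> \<sigma>) - law (real 0 * (1 / 64)) h\<bar> \<le> \<epsilon> * B"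
        using *(1) by simp
    qed
  next
    case (Suc k)
    show ?case using asymptotically_invariant_step[OF Suc, of "1 / 64"] by (simp add: field_simps)
  qed
  define k where "k = nat \<lfloor>64 * t\<rfloor>"
  have "real k = of_int \<lfloor>64 * t\<rfloor>" using assms by (simp add: k_def)
  hence "real k \<le> 64 * t" "64 * t \<le> real k + 1" by linarith+
  thus ?thesis
    using asymptotically_invariant_step[OF grid, of k "t - real k * (1 / 64)"] by simp
qed

end

section \<open>Translations and one-sided flips\<close>

definition translate :: "int \<Rightarrow> (int \<Rightarrow> nat set) \<Rightarrow> int \<Rightarrow> nat set" where
  "translate k \<zeta> = (\<lambda>x. \<zeta> (x + k))"

text \<open>Flipping the same issue at both ends preserves their difference set, so only the edge
  between \<open>n\<close> and \<open>n + 1\<close> notices the change.\<close>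

definition flip_right :: "int \<Rightarrow> (int \<Rightarrow> nat set) \<Rightarrow> int \<Rightarrow> nat set" where
  "flip_right n \<zeta> = (\<lambda>x. if n < x then flip_issue 0 (\<zeta> x) else \<zeta> x)"

lemma flip_issue_flip_issue: "flip_issue i (flip_issue i u) = u"
  by (auto simp: flip_issue_def)

lemma flip_issue_commute: "flip_issue i (flip_issue j u) = flip_issue j (flip_issue i u)"
  by (auto simp: flip_issue_def)

lemma sym_diff_flip_issue: "sym_diff (flip_issue i u) (flip_issue i v) = sym_diff u v"
  by (auto simp: flip_issue_def)

lemma hamming_flip_issue: "hamming (flip_issue i u) (flip_issue i v) = hamming u v"
  by (simp add: hamming_def sym_diff_flip_issue)

lemma jump_translate: "jump \<theta> (translate k \<zeta>) x y h = jump \<theta> \<zeta> (x + k) (y + k) (h \<circ> translate k)"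
proof -
  have "(translate k \<zeta>)(x := v) = translate k (\<zeta>(x + k := v))" for v
    by (auto simp: translate_def fun_eq_iff)
  thus ?thesis by (simp add: jump_def) (simp add: translate_def)
qed

lemma gen_translate: "deffuant_gen \<theta> ((\<lambda>x. x + k) ` S) (h \<circ> translate k) = deffuant_gen \<theta> S h \<circ> translate k"
proof
  fix \<zeta>
  have eq: "(\<lambda>\<xi>. h \<xi> - h (translate k \<zeta>)) \<circ> translate k = (\<lambda>\<xi>. (h \<circ> translate k) \<xi> - (h \<circ> translate k) \<zeta>)"
    by auto
  have "x - 1 + k = x + k - 1" "x + 1 + k = x + k + 1" for x by auto
  note sh = jump_translate[of \<theta> k \<zeta> _ "_ - 1", unfolded this] jump_translate[of \<theta> k \<zeta> _ "_ + 1", unfolded this]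
  show "deffuant_gen \<theta> ((\<lambda>x. x + k) ` S) (h \<circ> translate k) \<zeta> = (deffuant_gen \<theta> S h \<circ> translate k) \<zeta>"
    unfolding deffuant_gen_jump' o_apply[of "deffuant_gen \<theta> S h"]
    by (subst sum.reindex) (auto simp: sh eq)
qed

lemma local_fun_translate:
  assumes "local_fun S h"
  shows "local_fun ((\<lambda>x. x + k) ` S) (h \<circ> translate k)"
proof (rule local_funI)
  fix \<zeta> \<zeta>' :: "int \<Rightarrow> nat set" assume *: "\<And>x. x \<in> (\<lambda>x. x + k) ` S \<Longrightarrow> \<zeta> x = \<zeta>' x"
  show "(h \<circ> translate k) \<zeta> = (h \<circ> translate k) \<zeta>'"
    unfolding o_def by (rule local_funD[OF assms]) (simp add: translate_def *)
qed (use local_fun_finite[OF assms] in simp)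

lemma jump_flip_right:
  assumes "n < x \<longleftrightarrow> n < y"
  shows "jump \<theta> (flip_right n \<zeta>) x y h = jump \<theta> \<zeta> x y (h \<circ> flip_right n)"
proof -
  have 1: "(flip_right n \<zeta>)(x := flip_issue i (flip_right n \<zeta> x)) =
        flip_right n (\<zeta>(x := flip_issue i (\<zeta> x)))" for i
    by (simp add: flip_right_def fun_eq_iff flip_issue_commute[of i 0])
  have 2: "sym_diff (flip_right n \<zeta> x) (flip_right n \<zeta> y) = sym_diff (\<zeta> x) (\<zeta> y)"
    using assms sym_diff_flip_issue[of 0 "\<zeta> x" "\<zeta> y"] by (simp add: flip_right_def)
  hence 3: "hamming (flip_right n \<zeta> x) (flip_right n \<zeta> y) = hamming (\<zeta> x) (\<zeta> y)"
    by (simp add: hamming_def)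
  show ?thesis unfolding jump_def active_def 1 2 3 by simp
qed

text \<open>Only \<open>n\<close> and \<open>n + 1\<close> have a neighbour on the other side of the
  cut; a jump at any other site involves two opinions that are both flipped or both left
  alone.\<close>

lemma gen_flip_right:
  assumes "n \<notin> S" "n + 1 \<notin> S"
  shows "deffuant_gen \<theta> S (h \<circ> flip_right n) = deffuant_gen \<theta> S h \<circ> flip_right n"
proof
  fix \<zeta>
  have eq: "(\<lambda>\<xi>. h \<xi> - h (flip_right n \<zeta>)) \<circ> flip_right n =
      (\<lambda>\<xi>. (h \<circ> flip_right n) \<xi> - (h \<circ> flip_right n) \<zeta>)"
    by auto
  have side: "(n < x) = (n < x - 1)" "(n < x) = (n < x + 1)" if "x \<in> S" for x
  proof -
    have "x \<noteq> n" "x \<noteq> n + 1" using that assms by auto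
    thus "(n < x) = (n < x - 1)" "(n < x) = (n < x + 1)" by auto
  qed
  show "deffuant_gen \<theta> S (h \<circ> flip_right n) \<zeta> = (deffuant_gen \<theta> S h \<circ> flip_right n) \<zeta>"
    unfolding deffuant_gen_jump' o_apply[of "deffuant_gen \<theta> S h"]
    by (intro sum.cong refl arg_cong2[where f = "(+)"]) (simp_all only: jump_flip_right[OF side(1)] jump_flip_right[OF side(2)] eq)
qed

lemma local_fun_flip_right:
  assumes "local_fun S h"
  shows "local_fun S (h \<circ> flip_right n)"
proof (rule local_funI[OF local_fun_finite[OF assms]])
  fix \<zeta> \<zeta>' :: "int \<Rightarrow> nat set" assume *: "\<And>x. x \<in> S \<Longrightarrow> \<zeta> x = \<zeta>' x"
  show "(h \<circ> flip_right n) \<zeta> = (h \<circ> flip_right n) \<zeta>'"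
    unfolding o_def by (rule local_funD[OF assms]) (simp add: flip_right_def *)
qed

context deffuant
begin

section \<open>Translations and flips as symmetries of the initial law and the dynamics\<close>

lemma law_cylinder:
  assumes "finite S" "\<And>x. x \<in> S \<Longrightarrow> c x \<subseteq> {..<F}"
  shows "law 0 (\<lambda>\<zeta>. of_bool (\<forall>x\<in>S. \<zeta> x = c x)) = (1 / 2 ^ F) ^ card S"
proof -
  have "law 0 (\<lambda>\<zeta>. of_bool (\<forall>x\<in>S. \<zeta> x = c x)) =
      (\<integral>\<omega>. indicator {\<omega>\<in>space M. \<forall>x\<in>S. \<eta> 0 x \<omega> = c x} \<omega> \<partial>M)"
    unfolding law_def conf_def
    by (rule Bochner_Integration.integral_cong) (auto simp: indicator_def)
  also have "\<dots> = measure M {\<omega>\<in>space M. \<forall>x\<in>S. \<eta> 0 x \<omega> = c x}"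
    using sets_cylinder[OF assms(1), of 0 c] by simp
  also have "\<dots> = (1 / 2 ^ F) ^ card S"
    using init assms unfolding uniform_product_init_def by blast
  finally show ?thesis .
qed

lemma local_fun_cylinder: "finite S \<Longrightarrow> local_fun S (\<lambda>\<zeta>. of_bool (\<forall>x\<in>S. \<zeta> x = c x))"
  by (simp add: local_fun_def)

text \<open>Under the product measure the probability of a cylinder depends only on its number of
  sites, so it suffices that preimages of cylinders under \<open>\<sigma>\<close> are cylinders of
  the same size; \<open>local_fun_expand\<close> extends this to local functions.\<close>

lemma law_init_invariant:
  assumes h: "local_fun S h"
    and \<sigma>: "\<And>\<zeta>. \<zeta> \<in> configs F \<Longrightarrow> \<sigma> \<zeta> \<in> configs F"
    and cyl: "\<And>c. (\<And>x. x \<in> S \<Longrightarrow> c x \<subseteq> {..<F}) \<Longrightarrow> \<exists>S' c'. finite S' \<and> card S' = card S \<and>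
        (\<forall>x\<in>S'. c' x \<subseteq> {..<F}) \<and> (\<forall>\<zeta>\<in>configs F. (\<forall>x\<in>S. \<sigma> \<zeta> x = c x) \<longleftrightarrow> (\<forall>x\<in>S'. \<zeta> x = c' x))"
  shows "law 0 (h \<circ> \<sigma>) = law 0 h"
proof -
  note fin = local_fun_finite[OF h]
  let ?P = "PiE S (\<lambda>_. Pow {..<F})"
  have "\<forall>c\<in>?P. \<exists>g. (\<exists>S'. local_fun S' g) \<and> law 0 g = (1 / 2 ^ F) ^ card S \<and>
      (\<forall>\<zeta>\<in>configs F. of_bool (\<forall>x\<in>S. \<sigma> \<zeta> x = c x) = g \<zeta>)"
  proof
    fix c assume c: "c \<in> ?P"
    have "\<exists>S' c'. finite S' \<and> card S' = card S \<and> (\<forall>x\<in>S'. c' x \<subseteq> {..<F}) \<and>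
        (\<forall>\<zeta>\<in>configs F. (\<forall>x\<in>S. \<sigma> \<zeta> x = c x) \<longleftrightarrow> (\<forall>x\<in>S'. \<zeta> x = c' x))"
      by (rule cyl) (use c in \<open>auto simp: PiE_iff\<close>)
    then obtain S' c' where S': "finite S'" "card S' = card S" and c': "\<forall>x\<in>S'. c' x \<subseteq> {..<F}"
      and eq: "\<forall>\<zeta>\<in>configs F. (\<forall>x\<in>S. \<sigma> \<zeta> x = c x) \<longleftrightarrow> (\<forall>x\<in>S'. \<zeta> x = c' x)"
      by (elim exE conjE)
    show "\<exists>g. (\<exists>S'. local_fun S' g) \<and> law 0 g = (1 / 2 ^ F) ^ card S \<and>
      (\<forall>\<zeta>\<in>configs F. of_bool (\<forall>x\<in>S. \<sigma> \<zeta> x = c x) = g \<zeta>)"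
    proof (intro exI conjI ballI)
      show "local_fun S' (\<lambda>\<zeta>. of_bool (\<forall>x\<in>S'. \<zeta> x = c' x))"
        by (rule local_fun_cylinder[OF S'(1)])
      show "law 0 (\<lambda>\<zeta>. of_bool (\<forall>x\<in>S'. \<zeta> x = c' x)) = (1 / 2 ^ F) ^ card S"
        unfolding S'(2)[symmetric] by (rule law_cylinder[OF S'(1)]) (use c' in blast)
      show "of_bool (\<forall>x\<in>S. \<sigma> \<zeta> x = c x) = of_bool (\<forall>x\<in>S'. \<zeta> x = c' x)"
        if "\<zeta> \<in> configs F" for \<zeta>
        by (simp only: bspec[OF eq that])
    qed
  qed
  from bchoice[OF this] obtain g where
    "\<forall>c\<in>?P. (\<exists>S'. local_fun S' (g c)) \<and> law 0 (g c) = (1 / 2 ^ F) ^ card S \<and>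
      (\<forall>\<zeta>\<in>configs F. of_bool (\<forall>x\<in>S. \<sigma> \<zeta> x = c x) = g c \<zeta>)"
    by (elim exE)
  hence g: "\<exists>S'. local_fun S' (g c)" "law 0 (g c) = (1 / 2 ^ F) ^ card S"
      "\<And>\<zeta>. \<zeta> \<in> configs F \<Longrightarrow> of_bool (\<forall>x\<in>S. \<sigma> \<zeta> x = c x) = g c \<zeta>" if "c \<in> ?P" for c
    using that by simp_all
  have loc: "\<exists>S'. local_fun S' (\<lambda>\<zeta>. h c * g c \<zeta>)" if "c \<in> ?P" for c
    using g(1)[OF that] local_fun_comp[where g = "\<lambda>v. h c * v"] by blast
  have "law 0 (h \<circ> \<sigma>) = law 0 (\<lambda>\<zeta>. \<Sum>c\<in>?P. h c * g c \<zeta>)"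
    by (rule law_cong) (simp add: local_fun_expand[OF h \<sigma>] g(3))
  also have "\<dots> = (\<Sum>c\<in>?P. h c * (1 / 2 ^ F) ^ card S)"
    by (subst law_sum[OF loc]) (auto simp: law_cmult g(2))
  also have "\<dots> = (\<Sum>c\<in>?P. law 0 (\<lambda>\<zeta>. h c * of_bool (\<forall>x\<in>S. \<zeta> x = c x)))"
    by (intro sum.cong refl) (auto simp: law_cmult law_cylinder[OF fin] PiE_iff)
  also have "\<dots> = law 0 (\<lambda>\<zeta>. \<Sum>c\<in>?P. h c * of_bool (\<forall>x\<in>S. \<zeta> x = c x))"
    by (rule law_sum[symmetric])
      (rule exI, rule local_fun_comp[where g = "\<lambda>v. _ * v", OF local_fun_cylinder[OF fin]])
  also have "\<dots> = law 0 h"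
    by (rule law_cong) (simp add: local_fun_expand[OF h])
  finally show ?thesis .
qed

lemma symmetry_translate:
  assumes "finite P"
  shows "symmetry P m (translate k)"
  unfolding symmetry_def
proof (intro conjI ballI allI impI)
  show \<sigma>: "translate k \<zeta> \<in> configs F" if "\<zeta> \<in> configs F" for \<zeta>
    using that by (auto simp: configs_def translate_def)
  show "law 0 (h \<circ> translate k) = law 0 h" if h: "local_fun S h" for S h
  proof (rule law_init_invariant[OF h \<sigma>])
    fix c :: "int \<Rightarrow> nat set" assume "\<And>x. x \<in> S \<Longrightarrow> c x \<subseteq> {..<F}"
    thus "\<exists>S' c'. finite S' \<and> card S' = card S \<and> (\<forall>x\<in>S'. c' x \<subseteq> {..<F}) \<and>
        (\<forall>\<zeta>\<in>configs F. (\<forall>x\<in>S. translate k \<zeta> x = c x) \<longleftrightarrow> (\<forall>x\<in>S'. \<zeta> x = c' x))"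
      using local_fun_finite[OF h]
      by (intro exI[of _ "(\<lambda>x. x + k) ` S"] exI[of _ "\<lambda>x. c (x - k)"])
        (auto simp: translate_def card_image inj_on_def)
  qed
  show "\<exists>S. local_fun S (h \<circ> translate k) \<and> gen S (h \<circ> translate k) = gen (nbhd P w) h \<circ> translate k"
    if "local_fun (nbhd P w) h" for w h
    by (intro exI[of _ "(\<lambda>x. x + k) ` nbhd P w"] conjI local_fun_translate[OF that] gen_translate)
qed

lemma symmetry_flip_right:
  assumes "finite P" "\<And>w. w < m \<Longrightarrow> n \<notin> nbhd P w \<and> n + 1 \<notin> nbhd P w"
  shows "symmetry P m (flip_right n)"
  unfolding symmetry_def
proof (intro conjI ballI allI impI)
  have fl: "flip_issue 0 u \<subseteq> {..<F}" if "u \<subseteq> {..<F}" for u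
    using that issues_eq by (auto simp: flip_issue_def)
  show \<sigma>: "flip_right n \<zeta> \<in> configs F" if "\<zeta> \<in> configs F" for \<zeta>
    using that fl by (simp add: configs_def flip_right_def)
  show "law 0 (h \<circ> flip_right n) = law 0 h" if h: "local_fun S h" for S h
  proof (rule law_init_invariant[OF h \<sigma>])
    fix c :: "int \<Rightarrow> nat set" assume *: "\<And>x. x \<in> S \<Longrightarrow> c x \<subseteq> {..<F}"
    \<comment> \<open>The flip is an involution, so it can be moved from the configuration to the
      prescribed values.\<close>
    have "flip_right n \<zeta> x = c x \<longleftrightarrow> \<zeta> x = flip_right n c x" for \<zeta> x
      using flip_issue_flip_issue[of 0 "\<zeta> x"] flip_issue_flip_issue[of 0 "c x"] by (auto simp: flip_right_def)
    moreover have "flip_right n c x \<subseteq> {..<F}" if "x \<in> S" for x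
      using fl[OF *[OF that]] *[OF that] by (simp add: flip_right_def)
    ultimately show "\<exists>S' c'. finite S' \<and> card S' = card S \<and> (\<forall>x\<in>S'. c' x \<subseteq> {..<F}) \<and>
        (\<forall>\<zeta>\<in>configs F. (\<forall>x\<in>S. flip_right n \<zeta> x = c x) \<longleftrightarrow> (\<forall>x\<in>S'. \<zeta> x = c' x))"
      using local_fun_finite[OF h] by (intro exI[of _ S] exI[of _ "flip_right n c"]) simp
  qed
  show "\<exists>S. local_fun S (h \<circ> flip_right n) \<and>
      gen S (h \<circ> flip_right n) = gen (nbhd P w) h \<circ> flip_right n"
    if "w < m" "local_fun (nbhd P w) h" for w h
    using local_fun_flip_right[OF that(2)] gen_flip_right assms(2)[OF that(1)]
    by (intro exI[of _ "nbhd P w"]) simp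
qed

lemma local_fun_nbhd_zero:
  assumes "local_fun S h"
  obtains w where "local_fun (nbhd {0} w) h"
proof
  note fin = local_fun_finite[OF assms]
  \<comment> \<open>The sum of all absolute values is a radius that also makes sense for empty
    \<open>S\<close>.\<close>
  have "x \<in> {- int (\<Sum>y\<in>S. nat \<bar>y\<bar>)..int (\<Sum>y\<in>S. nat \<bar>y\<bar>)}" if "x \<in> S" for x
  proof -
    have "nat \<bar>x\<bar> \<le> (\<Sum>y\<in>S. nat \<bar>y\<bar>)"
      by (rule member_le_sum) (use that fin in auto)
    hence "\<bar>x\<bar> \<le> int (\<Sum>y\<in>S. nat \<bar>y\<bar>)" by (simp add: nat_le_iff)
    thus ?thesis by auto
  qed
  thus "local_fun (nbhd {0} (\<Sum>y\<in>S. nat \<bar>y\<bar>)) h"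
    by (intro local_fun_mono[OF assms]) (auto simp: nbhd_def simp del: of_nat_sum)
qed

text \<open>A translation is a symmetry for every \<open>m\<close>, so the approximate invariance
  holds with every \<epsilon> and becomes an equality.\<close>

theorem law_translate:
  assumes h: "local_fun S h" and t: "0 \<le> t"
  shows "law t (h \<circ> translate k) = law t h"
proof -
  obtain w where w: "local_fun (nbhd {0} w) h" using local_fun_nbhd_zero[OF h] .
  obtain B where B: "0 \<le> B" "\<And>\<zeta>. \<zeta> \<in> configs F \<Longrightarrow> \<bar>h \<zeta>\<bar> \<le> B"
    using local_fun_bounded[OF h] by metis
  have "\<bar>law t (h \<circ> translate k) - law t h\<bar> \<le> \<epsilon> * (B + 1)" if \<epsilon>: "\<epsilon> > 0" for \<epsilon>
  proof -
    obtain m where m: "\<And>P \<sigma> h B.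
     finite P \<Longrightarrow> card P \<le> 2 \<Longrightarrow> symmetry P m \<sigma> \<Longrightarrow> local_fun (nbhd P w) h \<Longrightarrow>
     (\<forall>\<zeta>\<in>configs F. \<bar>h \<zeta>\<bar> \<le> B) \<Longrightarrow> \<bar>law t (h \<circ> \<sigma>) - law t h\<bar> \<le> \<epsilon> * B"
      using asymptotically_invariant[OF t] \<epsilon> unfolding asymptotically_invariant_def by meson
    show ?thesis by (rule m[OF _ _ symmetry_translate w]) (use B in \<open>auto intro: add_increasing2\<close>)
  qed
  from this[of "e / (B + 1)" for e] have "\<bar>law t (h \<circ> translate k) - law t h\<bar> \<le> e" if "e > 0" for e
    using that B(1) by (simp add: add_nonneg_pos)
  hence "\<bar>law t (h \<circ> translate k) - law t h\<bar> \<le> 0"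
    by (rule field_le_epsilon[where y = 0, simplified])
  thus ?thesis by simp
qed

text \<open>This takes the place of a mixing property of the law at time t.\<close>

theorem law_flip_right:
  assumes t: "0 \<le> t" and \<epsilon>: "\<epsilon> > 0"
  obtains m where "\<And>x z n h. x + int m \<le> n \<Longrightarrow> n + int m \<le> z \<Longrightarrow>
      local_fun {x, x + 1, z, z + 1} h \<Longrightarrow> (\<And>\<zeta>. \<bar>h \<zeta>\<bar> \<le> 1) \<Longrightarrow>
      \<bar>law t (h \<circ> flip_right n) - law t h\<bar> \<le> \<epsilon>"
proof -
  obtain m where m: "\<And>P \<sigma> h B.
     finite P \<Longrightarrow> card P \<le> 2 \<Longrightarrow> symmetry P m \<sigma> \<Longrightarrow> local_fun (nbhd P 1) h \<Longrightarrow>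
     (\<forall>\<zeta>\<in>configs F. \<bar>h \<zeta>\<bar> \<le> B) \<Longrightarrow> \<bar>law t (h \<circ> \<sigma>) - law t h\<bar> \<le> \<epsilon> * B"
    using asymptotically_invariant[OF t] \<epsilon> unfolding asymptotically_invariant_def by meson
  show thesis
  \<comment> \<open>One more than \<open>m\<close>, since a ball of radius below \<open>m\<close>
    around \<open>z\<close> has to miss \<open>n + 1\<close> as well as \<open>n\<close>.\<close>
  proof (rule that[of "m + 1"])
    fix x z n h
    assume *: "x + int (m + 1) \<le> n" "n + int (m + 1) \<le> z"
      "local_fun {x, x + 1, z, z + 1} h" "\<And>\<zeta>. \<bar>h \<zeta>\<bar> \<le> 1"
    have sym: "symmetry {x, z} m (flip_right n)"
      by (rule symmetry_flip_right) (use * in \<open>auto simp: nbhd_def\<close>)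
    have loc: "local_fun (nbhd {x, z} 1) h"
      by (rule local_fun_mono[OF *(3)]) (auto simp: nbhd_def)
    have "\<bar>law t (h \<circ> flip_right n) - law t h\<bar> \<le> \<epsilon> * 1"
      by (rule m[OF _ _ sym loc]) (use *(4) in \<open>auto simp: card_insert_if\<close>)
    thus "\<bar>law t (h \<circ> flip_right n) - law t h\<bar> \<le> \<epsilon>" by simp
  qed
qed

end

section \<open>Reaching a clash inside a window\<close>

text \<open>Configurations from which the dynamics inside the window W can reach a moment where a
  disagreement on some issue may hop onto an edge already disagreeing on that issue.\<close>

inductive collides :: "nat \<Rightarrow> int set \<Rightarrow> (int \<Rightarrow> nat set) \<Rightarrow> bool" for \<theta> W where
  now: "x \<in> W \<Longrightarrow> x - d \<in> W \<Longrightarrow> x + d \<in> W \<Longrightarrow> d \<in> {1, - 1} \<Longrightarrow> active \<theta> (\<zeta> x) (\<zeta> (x - d)) \<Longrightarrow>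
    i \<in> sym_diff (\<zeta> x) (\<zeta> (x - d)) \<Longrightarrow> i \<in> sym_diff (\<zeta> x) (\<zeta> (x + d)) \<Longrightarrow> collides \<theta> W \<zeta>"
| step: "x \<in> W \<Longrightarrow> y \<in> W \<Longrightarrow> y \<in> {x - 1, x + 1} \<Longrightarrow> active \<theta> (\<zeta> x) (\<zeta> y) \<Longrightarrow>
    i \<in> sym_diff (\<zeta> x) (\<zeta> y) \<Longrightarrow> collides \<theta> W (\<zeta>(x := flip_issue i (\<zeta> x))) \<Longrightarrow> collides \<theta> W \<zeta>"

lemma full_sym_diff:
  assumes "u \<subseteq> {..<n}" "v \<subseteq> {..<n}" "hamming u v = n"
  shows "sym_diff u v = {..<n}"
  by (rule card_subset_eq) (use assms in \<open>auto simp: hamming_def\<close>)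

lemma hamming_le: "u \<subseteq> {..<n} \<Longrightarrow> v \<subseteq> {..<n} \<Longrightarrow> hamming u v \<le> n"
  unfolding hamming_def using card_mono[of "{..<n}" "sym_diff u v"] by auto

lemma hamming_eq_0:
  assumes "u \<subseteq> {..<n}" "v \<subseteq> {..<n}" "hamming u v = 0"
  shows "u = v"
proof -
  have "finite (sym_diff u v)" by (rule finite_subset[of _ "{..<n}"]) (use assms in auto)
  thus ?thesis using assms(3) by (auto simp: hamming_def)
qed

lemma opinion_cases:
  assumes "u \<subseteq> {..<Suc \<theta>}" "v \<subseteq> {..<Suc \<theta>}"
  obtains "u = v" | "active \<theta> u v" | "hamming u v = Suc \<theta>"
  using hamming_le[OF assms] hamming_eq_0[OF assms] by (fastforce simp: active_def)

lemma active_nonempty: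
  assumes "active \<theta> u v"
  obtains i where "i \<in> sym_diff u v"
proof -
  have "sym_diff u v \<noteq> {}" using assms by (auto simp: active_def hamming_def)
  thus ?thesis using that by blast
qed

text \<open>A full edge carries every issue, so any disagreement on the adjacent active edge clashes
  with it. The sign \<open>d\<close> covers both orientations.\<close>

lemma collides_next_to_full:
  assumes d: "d \<in> {1, - 1}" and W: "s \<in> W" "s + d \<in> W" "s + 2 * d \<in> W"
    and act: "active \<theta> (\<zeta> s) (\<zeta> (s + d))"
    and op: "\<zeta> s \<subseteq> {..<Suc \<theta>}" "\<zeta> (s + d) \<subseteq> {..<Suc \<theta>}" "\<zeta> (s + 2 * d) \<subseteq> {..<Suc \<theta>}"
    and full: "hamming (\<zeta> (s + d)) (\<zeta> (s + 2 * d)) = Suc \<theta>"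
  shows "collides \<theta> W \<zeta>"
proof -
  have act': "active \<theta> (\<zeta> (s + d)) (\<zeta> s)" using act active_commute by blast
  obtain i where i: "i \<in> sym_diff (\<zeta> (s + d)) (\<zeta> s)"
    using active_nonempty[OF act'] .
  hence "i \<in> {..<Suc \<theta>}" using op(1,2) by blast
  hence i': "i \<in> sym_diff (\<zeta> (s + d)) (\<zeta> (s + 2 * d))"
    using full_sym_diff[OF op(2,3) full] by blast
  have e: "s + d - d = s" "s + d + d = s + 2 * d" by auto
  show ?thesis
    by (rule collides.now[of "s + d" W d, unfolded e]) (fact W act' i i' d)+
qed

text \<open>Induction on the distance to the full edge. If the edge after the active one is full,
  the two clash; if it is active, it takes over as starting edge; if its ends agree,
  \<open>s + d\<close> imitates \<open>s\<close>, which moves one disagreement onto it. A lone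
  disagreement makes an edge active because \<open>1 \<le> \<theta>\<close>.\<close>

lemma collides_full:
  fixes d :: int
  assumes d: "d \<in> {1, - 1}" and \<theta>: "1 \<le> \<theta>"
  shows "\<forall>k\<le>Suc (Suc n). s + d * int k \<in> W \<Longrightarrow> \<forall>k\<le>Suc (Suc n). \<zeta> (s + d * int k) \<subseteq> {..<Suc \<theta>} \<Longrightarrow>
    active \<theta> (\<zeta> s) (\<zeta> (s + d)) \<Longrightarrow>
    hamming (\<zeta> (s + d * int (Suc n))) (\<zeta> (s + d * int (Suc (Suc n)))) = Suc \<theta> \<Longrightarrow> collides \<theta> W \<zeta>"
proof (induction n arbitrary: s \<zeta>)
  case 0
  have "s \<in> W" "s + d \<in> W" "s + 2 * d \<in> W"
    "\<zeta> s \<subseteq> {..<Suc \<theta>}" "\<zeta> (s + d) \<subseteq> {..<Suc \<theta>}" "\<zeta> (s + 2 * d) \<subseteq> {..<Suc \<theta>}"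
    using 0(1)[rule_format, of 0] 0(1)[rule_format, of 1] 0(1)[rule_format, of 2]
      0(2)[rule_format, of 0] 0(2)[rule_format, of 1] 0(2)[rule_format, of 2]
    by (simp_all add: mult.commute)
  thus ?case using collides_next_to_full[OF d] 0(3,4) by (simp add: mult.commute)
  next
  case (Suc n)
  have W: "s \<in> W" "s + d \<in> W" "s + 2 * d \<in> W"
    and op: "\<zeta> s \<subseteq> {..<Suc \<theta>}" "\<zeta> (s + d) \<subseteq> {..<Suc \<theta>}" "\<zeta> (s + 2 * d) \<subseteq> {..<Suc \<theta>}"
    using Suc(2)[rule_format, of 0] Suc(2)[rule_format, of 1] Suc(2)[rule_format, of 2]
      Suc(3)[rule_format, of 0] Suc(3)[rule_format, of 1] Suc(3)[rule_format, of 2]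
    by (simp_all add: mult.commute)
  have next_site: "s + d + d * int k = s + d * int (Suc k)" for k by (simp add: algebra_simps)
  have W': "\<forall>k\<le>Suc (Suc n). s + d + d * int k \<in> W"
    unfolding next_site using Suc(2) by blast
  have e: "s + d + d = s + 2 * d" by simp
  from op(2,3) show ?case
  proof (cases rule: opinion_cases)
    case 3
    thus ?thesis by (rule collides_next_to_full[OF d W Suc(4) op])
  next
    case 2
    show ?thesis
    proof (rule Suc.IH[OF W'])
      show "\<forall>k\<le>Suc (Suc n). \<zeta> (s + d + d * int k) \<subseteq> {..<Suc \<theta>}"
        unfolding next_site using Suc(3) by blast
      show "active \<theta> (\<zeta> (s + d)) (\<zeta> (s + d + d))" unfolding e by (rule 2)
      show "hamming (\<zeta> (s + d + d * int (Suc n))) (\<zeta> (s + d + d * int (Suc (Suc n)))) = Suc \<theta>"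
        unfolding next_site by (rule Suc(5))
    qed
  next
    case 1
    obtain i where i: "i \<in> sym_diff (\<zeta> (s + d)) (\<zeta> s)"
      using active_nonempty[OF Suc(4)] by blast
    define \<zeta>' where "\<zeta>' = \<zeta>(s + d := flip_issue i (\<zeta> (s + d)))"
    have i\<theta>: "i < Suc \<theta>" using i op by blast
    have far: "\<zeta>' (s + d * int k) = \<zeta> (s + d * int k)" if "k \<noteq> 1" for k
      using that d by (auto simp: \<zeta>'_def)
    have "collides \<theta> W \<zeta>'"
    proof (rule Suc.IH[OF W'])
      show "\<forall>k\<le>Suc (Suc n). \<zeta>' (s + d + d * int k) \<subseteq> {..<Suc \<theta>}"
        unfolding next_site
      proof (intro allI impI)
        fix k assume "k \<le> Suc (Suc n)"
        thus "\<zeta>' (s + d * int (Suc k)) \<subseteq> {..<Suc \<theta>}"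
          using Suc(3)[rule_format, of "Suc k"] op(2) i\<theta>
          by (cases "k = 0") (auto simp: \<zeta>'_def flip_issue_def far split: if_splits)
      qed
      have "sym_diff (\<zeta>' (s + d)) (\<zeta>' (s + d + d)) = {i}"
        unfolding e using 1 d by (auto simp: \<zeta>'_def flip_issue_def)
      thus "active \<theta> (\<zeta>' (s + d)) (\<zeta>' (s + d + d))"
        using \<theta> by (simp add: active_def hamming_def)
      show "hamming (\<zeta>' (s + d + d * int (Suc n))) (\<zeta>' (s + d + d * int (Suc (Suc n)))) = Suc \<theta>"
        unfolding next_site using Suc(5) by (simp add: far del: of_nat_Suc)
    qed
    thus ?thesis
      unfolding \<zeta>'_def
      by (intro collides.step[of "s + d" W s \<theta> \<zeta> i])
        (use W d i Suc(4) active_commute in auto)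
  qed
qed

text \<open>The disagreement on \<open>i\<close> travels from \<open>x\<close> towards
  \<open>z\<close>. At each step it clashes, or fills up an edge, which the still untouched edge at
  \<open>z\<close> then reaches from the right by \<open>collides_full\<close>, or gets one edge
  closer with still no full edge in the window.\<close>

lemma collides_pair:
  assumes \<theta>: "1 \<le> \<theta>"
  shows "a \<le> x \<Longrightarrow> x < z \<Longrightarrow> z < b \<Longrightarrow> \<forall>y\<in>{a..b}. \<zeta> y \<subseteq> {..<Suc \<theta>} \<Longrightarrow>
    \<forall>y\<in>{a..<b}. hamming (\<zeta> y) (\<zeta> (y + 1)) \<noteq> Suc \<theta> \<Longrightarrow>
    i \<in> sym_diff (\<zeta> x) (\<zeta> (x + 1)) \<Longrightarrow> i \<in> sym_diff (\<zeta> z) (\<zeta> (z + 1)) \<Longrightarrow> collides \<theta> {a..b} \<zeta>"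
proof (induction "nat (z - x)" arbitrary: x \<zeta> rule: less_induct)
  case less
  note ord = less(2-4) and op = less(5)[rule_format] and nofull = less(6)[rule_format]
    and ix = less(7) and iz = less(8)
  have act: "active \<theta> (\<zeta> y) (\<zeta> (y + 1))" if "a \<le> y" "y < b" "\<zeta> y \<noteq> \<zeta> (y + 1)" for y
    using opinion_cases[of "\<zeta> y" \<theta> "\<zeta> (y + 1)"] op[of y] op[of "y + 1"] nofull[of y] that by auto
  have actx: "active \<theta> (\<zeta> (x + 1)) (\<zeta> x)"
    using act[of x] ord ix active_commute by auto
  show ?case
  proof (cases "i \<in> sym_diff (\<zeta> (x + 1)) (\<zeta> (x + 1 + 1))")
    case True
    thus ?thesis
      by (intro collides.now[of "x + 1" _ 1 \<theta> \<zeta> i]) (use ord actx ix in auto)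
  next
    case False
    hence z: "x + 2 \<le> z" using iz ord by (cases "z = x + 1") auto
    define \<zeta>' where "\<zeta>' = \<zeta>(x + 1 := flip_issue i (\<zeta> (x + 1)))"
    have same: "\<zeta>' y = \<zeta> y" if "y \<noteq> x + 1" for y using that by (simp add: \<zeta>'_def)
    have "i < Suc \<theta>" using ix op[of x] op[of "x + 1"] ord by auto
    hence op': "\<zeta>' y \<subseteq> {..<Suc \<theta>}" if "y \<in> {a..b}" for y
      using op[OF that] by (auto simp: \<zeta>'_def flip_issue_def split: if_splits)
    have i': "i \<in> sym_diff (\<zeta>' (x + 1)) (\<zeta>' (x + 1 + 1))"
      using False by (auto simp: \<zeta>'_def flip_issue_def)
    have iz': "i \<in> sym_diff (\<zeta>' z) (\<zeta>' (z + 1))" using iz z by (simp add: same)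
    have "collides \<theta> {a..b} \<zeta>'"
    proof (cases "hamming (\<zeta>' (x + 1)) (\<zeta>' (x + 1 + 1)) = Suc \<theta>")
      case True
      \<comment> \<open>Read from \<open>z + 1\<close> leftwards, the active edge comes first and
        the newly full edge between \<open>x + 2\<close> and \<open>x + 1\<close> begins
        \<open>n + 1\<close> steps later.\<close>
      define n where "n = nat (z - x - 2)"
      have n: "int n = z - x - 2" using z by (simp add: n_def)
      have k: "z + 1 + - 1 * int k \<in> {a..b}" if "k \<le> Suc (Suc n)" for k
      proof -
        have "int k \<le> z - x" using that n by linarith
        thus ?thesis using ord by simp
      qed
      show ?thesis
      proof (rule collides_full[of "- 1" \<theta> n "z + 1"])
        show "\<forall>k\<le>Suc (Suc n). z + 1 + - 1 * int k \<in> {a..b}" using k by blast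
        show "\<forall>k\<le>Suc (Suc n). \<zeta>' (z + 1 + - 1 * int k) \<subseteq> {..<Suc \<theta>}" using k op' by blast
        have "active \<theta> (\<zeta> z) (\<zeta> (z + 1))" using act[of z] iz ord by auto
        thus "active \<theta> (\<zeta>' (z + 1)) (\<zeta>' (z + 1 + - 1))"
          using z active_commute by (simp add: same)
        have "z + 1 + - 1 * int (Suc n) = x + 1 + 1" "z + 1 + - 1 * int (Suc (Suc n)) = x + 1"
          using n by auto
        thus "hamming (\<zeta>' (z + 1 + - 1 * int (Suc n))) (\<zeta>' (z + 1 + - 1 * int (Suc (Suc n)))) = Suc \<theta>"
          using True hamming_commute by metis
      qed (use \<theta> in auto)
    next
      case notfull: False
      show ?thesis
      proof (rule less(1)[of "x + 1" \<zeta>'])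
        show "\<forall>y\<in>{a..<b}. hamming (\<zeta>' y) (\<zeta>' (y + 1)) \<noteq> Suc \<theta>"
        proof
          fix y assume y: "y \<in> {a..<b}"
          consider "y = x" | "y = x + 1" | "y \<noteq> x" "y \<noteq> x + 1" by blast
          thus "hamming (\<zeta>' y) (\<zeta>' (y + 1)) \<noteq> Suc \<theta>"
          proof cases
            \<comment> \<open>The edge left behind no longer carries issue \<open>i\<close>, so it
              cannot be full.\<close>
            case 1
            have "i \<notin> sym_diff (\<zeta>' x) (\<zeta>' (x + 1))"
              using ix by (auto simp: \<zeta>'_def flip_issue_def)
            moreover have "\<zeta>' x \<subseteq> {..<Suc \<theta>}" "\<zeta>' (x + 1) \<subseteq> {..<Suc \<theta>}"
              using op' ord by auto
            ultimately show ?thesis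
              using full_sym_diff[of "\<zeta>' x" "Suc \<theta>" "\<zeta>' (x + 1)"] \<open>i < Suc \<theta>\<close> 1 by auto
          qed (use notfull nofull[OF y] same in auto)
        qed
        show "\<forall>y\<in>{a..b}. \<zeta>' y \<subseteq> {..<Suc \<theta>}" using op' by blast
      qed (use ord z i' iz' in auto)
    qed
    thus ?thesis
      unfolding \<zeta>'_def
      by (intro collides.step[of "x + 1" "{a..b}" x \<theta> \<zeta> i]) (use ord actx ix in auto)
  qed
qed

text \<open>With a full edge in the window, \<open>collides_full\<close> leads from the active edge
  to it, in one direction or the other. Without one, there are more disagreements than issues, so
  two edges share an issue and \<open>collides_pair\<close> applies.\<close>

lemma collides_window:
  assumes \<theta>: "1 \<le> \<theta>" and op: "\<And>y. y \<in> {a..b} \<Longrightarrow> \<zeta> y \<subseteq> {..<Suc \<theta>}"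
    and x: "a \<le> x" "x < b" "active \<theta> (\<zeta> x) (\<zeta> (x + 1))"
    and many: "Suc \<theta> < (\<Sum>y\<in>{a..<b}. hamming (\<zeta> y) (\<zeta> (y + 1)))"
  shows "collides \<theta> {a..b} \<zeta>"
proof (cases "\<exists>z\<in>{a..<b}. hamming (\<zeta> z) (\<zeta> (z + 1)) = Suc \<theta>")
  case True
  then obtain z where z: "a \<le> z" "z < b" "hamming (\<zeta> z) (\<zeta> (z + 1)) = Suc \<theta>" by auto
  have "z \<noteq> x" using x z by (auto simp: active_def)
  then consider "x < z" | "z < x" by linarith
  thus ?thesis
  proof cases
    case 1
    define n where "n = nat (z - x - 1)"
    have n: "int n = z - x - 1" using 1 by (simp add: n_def)
    have k: "x + 1 * int k \<in> {a..b}" if "k \<le> Suc (Suc n)" for k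
      using that n x z by auto
    have e: "x + 1 * int (Suc n) = z" "x + 1 * int (Suc (Suc n)) = z + 1" using n by auto
    show ?thesis
      by (rule collides_full[of 1 \<theta> n x, unfolded e]) (use k op \<theta> x z in auto)
  next
    case 2
    define n where "n = nat (x - z - 1)"
    have n: "int n = x - z - 1" using 2 by (simp add: n_def)
    have k: "x + 1 + - 1 * int k \<in> {a..b}" if "k \<le> Suc (Suc n)" for k
    proof -
      have "int k \<le> x - z + 1" using that n by linarith
      thus ?thesis using x z by simp
    qed
    have e: "x + 1 + - 1 * int (Suc n) = z + 1" "x + 1 + - 1 * int (Suc (Suc n)) = z"
      using n by auto
    show ?thesis
    proof (rule collides_full[of "- 1" \<theta> n "x + 1", unfolded e])
      show "active \<theta> (\<zeta> (x + 1)) (\<zeta> (x + 1 + - 1))"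
        using x(3) active_commute by simp
      show "hamming (\<zeta> (z + 1)) (\<zeta> z) = Suc \<theta>" using z(3) hamming_commute by simp
    qed (use k op \<theta> in auto)
  qed
next
  case False
  have sub: "(\<Union>y\<in>{a..<b}. sym_diff (\<zeta> y) (\<zeta> (y + 1))) \<subseteq> {..<Suc \<theta>}"
  proof (rule UN_least)
    fix y assume "y \<in> {a..<b}"
    thus "sym_diff (\<zeta> y) (\<zeta> (y + 1)) \<subseteq> {..<Suc \<theta>}"
      using op[of y] op[of "y + 1"] by auto
  qed
  have "\<exists>p q i. a \<le> p \<and> p < q \<and> q < b \<and> i \<in> sym_diff (\<zeta> p) (\<zeta> (p + 1)) \<and> i \<in> sym_diff (\<zeta> q) (\<zeta> (q + 1))"
  proof (rule ccontr)
    assume no: "\<not> ?thesis"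
    \<comment> \<open>If no issue occurred on two edges, the disagreement sets would be disjoint
      subsets of \<open>{..<Suc \<theta>}\<close>, which is too small to hold them all.\<close>
    have "card (\<Union>y\<in>{a..<b}. sym_diff (\<zeta> y) (\<zeta> (y + 1))) =
        (\<Sum>y\<in>{a..<b}. card (sym_diff (\<zeta> y) (\<zeta> (y + 1))))"
    proof (rule card_UN_disjoint)
      show "\<forall>y\<in>{a..<b}. finite (sym_diff (\<zeta> y) (\<zeta> (y + 1)))"
        using sub finite_subset[of _ "{..<Suc \<theta>}"] by (meson UN_upper finite_lessThan order_trans)
      show "\<forall>p\<in>{a..<b}. \<forall>q\<in>{a..<b}. p \<noteq> q \<longrightarrow>
          sym_diff (\<zeta> p) (\<zeta> (p + 1)) \<inter> sym_diff (\<zeta> q) (\<zeta> (q + 1)) = {}"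
      proof (intro ballI impI)
        fix p q assume pq: "p \<in> {a..<b}" "q \<in> {a..<b}" "p \<noteq> q"
        have "\<not> (i \<in> sym_diff (\<zeta> p) (\<zeta> (p + 1)) \<and> i \<in> sym_diff (\<zeta> q) (\<zeta> (q + 1)))" for i
          using no pq by (cases "p < q") (force, force)
        thus "sym_diff (\<zeta> p) (\<zeta> (p + 1)) \<inter> sym_diff (\<zeta> q) (\<zeta> (q + 1)) = {}" by blast
      qed
    qed simp
    also have "\<dots> = (\<Sum>y\<in>{a..<b}. hamming (\<zeta> y) (\<zeta> (y + 1)))" by (simp add: hamming_def)
    finally show False
      using card_mono[OF _ sub] many by simp
  qed
  then obtain p q i where "a \<le> p" "p < q" "q < b"
    "i \<in> sym_diff (\<zeta> p) (\<zeta> (p + 1))" "i \<in> sym_diff (\<zeta> q) (\<zeta> (q + 1))"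
    by (elim exE conjE)
  thus ?thesis
    by (intro collides_pair[OF \<theta>, of a p q b \<zeta> i]) (use op False in auto)
qed

section \<open>Active edges disappear\<close>

lemma sum_one_minus_of_bool:
  assumes "finite D"
  shows "(\<Sum>i\<in>D. 1 - 2 * of_bool (i \<in> E) :: real) = real (card D) - 2 * real (card (D \<inter> E))"
  using assms by (simp add: sum_subtractf flip: sum_distrib_left)

context deffuant
begin

definition act_at :: "int \<Rightarrow> (int \<Rightarrow> nat set) \<Rightarrow> real" where
  "act_at x \<zeta> = of_bool (active \<theta> (\<zeta> x) (\<zeta> (x + 1)))"

definition disagree :: "int \<Rightarrow> (int \<Rightarrow> nat set) \<Rightarrow> real" where
  "disagree x \<zeta> = real (hamming (\<zeta> x) (\<zeta> (x + 1)))"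

definition full :: "int \<Rightarrow> (int \<Rightarrow> nat set) \<Rightarrow> real" where
  "full x \<zeta> = of_bool (hamming (\<zeta> x) (\<zeta> (x + 1)) = F)"

text \<open>The rate at which disagreements are lost because x, imitating y, moves one of them onto the edge to z.
  The factor 1/2 of the jump rate cancels against the two disagreements that annihilate.\<close>

definition clash :: "(int \<Rightarrow> nat set) \<Rightarrow> int \<Rightarrow> int \<Rightarrow> int \<Rightarrow> real" where
  "clash \<zeta> y x z = (if active \<theta> (\<zeta> x) (\<zeta> y)
     then real (card (sym_diff (\<zeta> x) (\<zeta> y) \<inter> sym_diff (\<zeta> x) (\<zeta> z))) / real (hamming (\<zeta> x) (\<zeta> y))
     else 0)"

text \<open>Indexed by the left end of the edge that is hit: a hop can come from the left, when
  \<open>x\<close> imitates \<open>x - 1\<close>, or from the right, when \<open>x + 1\<close>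
  imitates \<open>x + 2\<close>.\<close>

definition clash_at :: "int \<Rightarrow> (int \<Rightarrow> nat set) \<Rightarrow> real" where
  "clash_at x \<zeta> = clash \<zeta> (x - 1) x (x + 1) + clash \<zeta> (x + 2) (x + 1) x"

definition cyl :: "int set \<Rightarrow> (int \<Rightarrow> nat set) \<Rightarrow> (int \<Rightarrow> nat set) \<Rightarrow> real" where
  "cyl W c \<zeta> = of_bool (\<forall>x\<in>W. \<zeta> x = c x)"

lemma local_fun_act_at: "local_fun {x, x + 1} (act_at x)"
  by (simp add: local_fun_def act_at_def)

lemma local_fun_disagree: "local_fun {x, x + 1} (disagree x)"
  by (simp add: local_fun_def disagree_def)

lemma local_fun_full: "local_fun {x, x + 1} (full x)"
  by (simp add: local_fun_def full_def)

lemma local_fun_clash_at: "local_fun {x - 1, x, x + 1, x + 2} (clash_at x)"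
  by (simp add: local_fun_def clash_at_def clash_def)

lemma local_fun_cyl: "finite W \<Longrightarrow> local_fun W (cyl W c)"
  by (simp add: local_fun_def cyl_def)

lemma clash_nonneg: "0 \<le> clash \<zeta> y x z"
  by (simp add: clash_def)

lemma clash_at_nonneg: "0 \<le> clash_at x \<zeta>"
  by (simp add: clash_at_def clash_nonneg)

section \<open>Translation invariance and the balance of disagreements\<close>

lemma law_at:
  assumes "local_fun S (f 0)" "0 \<le> t" "\<And>\<zeta>. f x \<zeta> = f 0 (translate x \<zeta>)"
  shows "law t (f x) = law t (f 0)"
proof -
  have "f x = f 0 \<circ> translate x" using assms(3) by (simp add: fun_eq_iff)
  thus ?thesis using law_translate[OF assms(1,2)] by simp
qed

lemma law_act_at: "0 \<le> t \<Longrightarrow> law t (act_at x) = law t (act_at 0)"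
  by (rule law_at[OF local_fun_act_at]) (simp_all add: act_at_def translate_def add.commute)

lemma law_disagree: "0 \<le> t \<Longrightarrow> law t (disagree x) = law t (disagree 0)"
  by (rule law_at[OF local_fun_disagree]) (simp_all add: disagree_def translate_def add.commute)

lemma law_full: "0 \<le> t \<Longrightarrow> law t (full x) = law t (full 0)"
  by (rule law_at[OF local_fun_full]) (simp_all add: full_def translate_def add.commute)

lemma law_clash_at: "0 \<le> t \<Longrightarrow> law t (clash_at x) = law t (clash_at 0)"
  by (rule law_at[OF local_fun_clash_at]) (simp_all add: clash_at_def clash_def translate_def add.commute)

text \<open>Flipping issue \<open>i\<close> removes a disagreement between \<open>x\<close> and
  \<open>z\<close> if there is one on \<open>i\<close> and creates one otherwise, a change of
  \<open>1 - 2 * of_bool (i \<in> ?E)\<close>; averaging over \<open>i\<close> and halving gives the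
  two terms.\<close>

lemma jump_hamming:
  assumes \<zeta>: "\<zeta> \<in> configs F" and ne: "z \<noteq> x"
  shows "jump \<theta> \<zeta> x y (\<lambda>\<xi>. real (hamming (\<xi> x) (\<xi> z)) - real (hamming (\<zeta> x) (\<zeta> z))) =
    of_bool (active \<theta> (\<zeta> x) (\<zeta> y)) / 2 - clash \<zeta> y x z"
proof (cases "active \<theta> (\<zeta> x) (\<zeta> y)")
  case True
  let ?D = "sym_diff (\<zeta> x) (\<zeta> y)" and ?E = "sym_diff (\<zeta> x) (\<zeta> z)"
  have fin: "finite ?D" "finite ?E" using configs_finite[OF \<zeta>] by auto
  have H: "real (hamming (\<zeta> x) (\<zeta> y)) = real (card ?D)" "card ?D \<noteq> 0"
    using True by (auto simp: hamming_def active_def)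
  have flip: "real (hamming (flip_issue i (\<zeta> x)) (\<zeta> z)) - real (hamming (\<zeta> x) (\<zeta> z)) =
      1 - 2 * of_bool (i \<in> ?E)" for i
  proof (cases "i \<in> ?E")
    case True
    hence "sym_diff (flip_issue i (\<zeta> x)) (\<zeta> z) = ?E - {i}"
      by (auto simp: flip_issue_def)
    moreover have "card ?E = Suc (card (?E - {i}))"
      using card.remove[OF fin(2) True] .
    ultimately show ?thesis using True by (simp add: hamming_def)
  next
    case False
    hence "sym_diff (flip_issue i (\<zeta> x)) (\<zeta> z) = insert i ?E"
      by (auto simp: flip_issue_def)
    thus ?thesis using False fin(2) by (simp add: hamming_def)
  qed
  have sum: "(\<Sum>i\<in>?D. real (hamming ((\<zeta>(x := flip_issue i (\<zeta> x))) x) ((\<zeta>(x := flip_issue i (\<zeta> x))) z)) -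
      real (hamming (\<zeta> x) (\<zeta> z))) = real (card ?D) - 2 * real (card (?D \<inter> ?E))"
    unfolding sum_one_minus_of_bool[OF fin(1), symmetric]
    by (rule sum.cong[OF refl]) (use ne flip in simp)
  show ?thesis
    using True H(2) unfolding jump_def sum clash_def H(1) by (simp add: diff_divide_distrib)
qed (simp add: jump_def clash_def)

lemma clash_self:
  "clash \<zeta> y x y = of_bool (active \<theta> (\<zeta> x) (\<zeta> y))"
  by (auto simp: clash_def hamming_def active_def)

text \<open>Conservation up to clashes: an active edge sends out disagreements at total rate 1, half
  from each end, and receives them from each active neighbour at rate 1/2. The activity terms form
  half a discrete Laplacian, which translation invariance removes in expectation.\<close>

lemma gen_disagree:
  assumes "\<zeta> \<in> configs F"
  shows "gen {0, 1} (disagree 0) \<zeta> =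
    act_at (- 1) \<zeta> / 2 + act_at 1 \<zeta> / 2 - act_at 0 \<zeta> - clash_at 0 \<zeta>"
proof -
  have 1: "jump \<theta> \<zeta> 1 y (\<lambda>\<xi>. real (hamming (\<xi> 0) (\<xi> 1)) - real (hamming (\<zeta> 0) (\<zeta> 1))) =
      of_bool (active \<theta> (\<zeta> 1) (\<zeta> y)) / 2 - clash \<zeta> y 1 0" for y
    using jump_hamming[OF assms, of 0 1 y] by (simp add: hamming_commute)
  show ?thesis
    unfolding deffuant_gen_jump' disagree_def
    by (simp add: jump_hamming[OF assms] 1 clash_self act_at_def clash_at_def
      active_commute[of _ "\<zeta> 0" "\<zeta> (- 1)"] active_commute[of _ "\<zeta> 1" "\<zeta> 0"])
qed

lemma law_gen_disagree:
  assumes "0 \<le> t"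
  shows "law t (gen {0, 1} (disagree 0)) = - law t (clash_at 0)"
proof -
  note i = integrable_local[OF local_fun_act_at] integrable_local[OF local_fun_clash_at]
  have "law t (gen {0, 1} (disagree 0)) =
      law t (\<lambda>\<zeta>. act_at (- 1) \<zeta> / 2 + act_at 1 \<zeta> / 2 - act_at 0 \<zeta> - clash_at 0 \<zeta>)"
    by (rule law_cong) (rule gen_disagree)
  also have "\<dots> = law t (act_at (- 1)) / 2 + law t (act_at 1) / 2 - law t (act_at 0) - law t (clash_at 0)"
    unfolding law_def by (simp add: i)
  also have "\<dots> = - law t (clash_at 0)"
    using law_act_at[OF assms, of "- 1"] law_act_at[OF assms, of 1] by simp
  finally show ?thesis .
qed

lemma law_disagree_derivative:
  "0 \<le> t \<Longrightarrow> ((\<lambda>t. law t (disagree 0)) has_real_derivative - law t (clash_at 0)) (at t within {0..})"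
  using law_has_derivative[OF local_fun_disagree[of 0]] law_gen_disagree by simp

lemma at_within_pos: "0 < t \<Longrightarrow> at t within {0..} = at (t :: real)"
  by (rule at_within_interior) simp

lemma law_disagree_antimono:
  assumes "0 < s" "s \<le> t"
  shows "law t (disagree 0) \<le> law s (disagree 0)"
proof (rule DERIV_nonpos_imp_nonincreasing[OF assms(2)])
  fix r assume "s \<le> r" "r \<le> t"
  hence "((\<lambda>t. law t (disagree 0)) has_real_derivative - law r (clash_at 0)) (at r)"
    using law_disagree_derivative[of r] assms by (simp add: at_within_pos)
  moreover have "- law r (clash_at 0) \<le> 0"
    using law_nonneg[of "clash_at 0" r] clash_at_nonneg by simp
  ultimately show "\<exists>y. ((\<lambda>t. law t (disagree 0)) has_real_derivative y) (at r) \<and> y \<le> 0" by blast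
qed

text \<open>Only positive times enter, because monotonicity rests on two-sided derivatives; for a
  nonincreasing function the infimum is the limit at infinity.\<close>

definition disagree_limit :: real where
  "disagree_limit = (INF t\<in>{0<..}. law t (disagree 0))"

lemma law_disagree_nonneg: "0 \<le> law t (disagree 0)"
  by (rule law_nonneg) (simp add: disagree_def)

lemma disagree_limit_le: "0 < t \<Longrightarrow> disagree_limit \<le> law t (disagree 0)"
  unfolding disagree_limit_def
  by (rule cINF_lower) (auto intro: law_disagree_nonneg bdd_belowI[of _ 0])

lemma law_disagree_tendsto: "((\<lambda>t. law t (disagree 0)) \<longlongrightarrow> disagree_limit) at_top"
proof (rule decreasing_tendsto)
  show "\<forall>\<^sub>F t in at_top. disagree_limit \<le> law t (disagree 0)"
    using eventually_gt_at_top[of 0] by eventually_elim (rule disagree_limit_le)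
  fix x assume "disagree_limit < x"
  then obtain s where s: "0 < s" "law s (disagree 0) < x"
    unfolding disagree_limit_def
    by (subst (asm) cINF_less_iff) (auto intro: law_disagree_nonneg bdd_belowI[of _ 0])
  show "\<forall>\<^sub>F t in at_top. law t (disagree 0) < x"
    using eventually_ge_at_top[of s]
    by eventually_elim (use law_disagree_antimono[OF s(1)] s(2) in force)
qed

text \<open>The clash rate is minus the derivative of a convergent expectation, hence tends to 0 by
  \<open>law_gen_tendsto_zero\<close>.\<close>

lemma law_clash_tendsto: "((\<lambda>t. law t (clash_at x)) \<longlongrightarrow> 0) at_top"
proof -
  have "((\<lambda>t. - law t (gen {0, 0 + 1} (disagree 0))) \<longlongrightarrow> - 0) at_top"
    by (intro tendsto_minus law_gen_tendsto_zero[OF local_fun_disagree law_disagree_tendsto])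
  moreover have "\<forall>\<^sub>F t in at_top. - law t (gen {0, 0 + 1} (disagree 0)) = law t (clash_at x)"
    using eventually_ge_at_top[of 0]
    by eventually_elim (simp add: law_gen_disagree law_clash_at[of _ x])
  ultimately show ?thesis using tendsto_cong by fastforce
qed

section \<open>Vanishing probability of states that lead to a clash\<close>

lemma law_dominated_tendsto:
  assumes "local_fun S f" "local_fun S' g" "((\<lambda>t. law t g) \<longlongrightarrow> 0) at_top"
    and "\<And>\<zeta>. \<zeta> \<in> configs F \<Longrightarrow> 0 \<le> f \<zeta>" "\<And>\<zeta>. \<zeta> \<in> configs F \<Longrightarrow> f \<zeta> \<le> K * g \<zeta>"
  shows "((\<lambda>t. law t f) \<longlongrightarrow> 0) at_top"
proof (rule tendsto_sandwich[where f = "\<lambda>_. 0" and h = "\<lambda>t. K * law t g"])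
  show "((\<lambda>t. K * law t g) \<longlongrightarrow> 0) at_top"
    using tendsto_mult_left[OF assms(3), of K] by simp
  show "\<forall>\<^sub>F t in at_top. law t f \<le> K * law t g"
    using law_mono[OF assms(1) local_fun_comp[OF assms(2), of "\<lambda>v. K * v"] assms(5)]
    by (simp add: law_cmult)
qed (use law_nonneg assms(4) in auto)

lemma clash_lower_bound:
  assumes "active \<theta> (\<zeta> x) (\<zeta> y)" "i \<in> sym_diff (\<zeta> x) (\<zeta> y)" "i \<in> sym_diff (\<zeta> x) (\<zeta> z)"
  shows "1 \<le> real \<theta> * clash \<zeta> y x z"
proof -
  let ?I = "sym_diff (\<zeta> x) (\<zeta> y) \<inter> sym_diff (\<zeta> x) (\<zeta> z)" and ?H = "hamming (\<zeta> x) (\<zeta> y)"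
  have "0 < card ?I"
    using assms(2,3) finite_sym_diff_active[OF assms(1)] by (subst card_gt_0_iff) blast
  hence "1 * 1 \<le> (real \<theta> / real ?H) * real (card ?I)"
    using assms(1) by (intro mult_mono) (auto simp: active_def)
  thus ?thesis using assms(1) by (simp add: clash_def)
qed

text \<open>Clashes die out because each of them destroys disagreements; hence so does every
  configuration of a window that leads to a clash with positive probability.\<close>

lemma collides_vanishes:
  assumes "finite W" "collides \<theta> W c"
  shows "((\<lambda>t. law t (cyl W c)) \<longlongrightarrow> 0) at_top"
  using assms(2)
proof (induction rule: collides.induct)
  case (now x d c i)
  \<comment> \<open>\<open>clash_at\<close> is indexed by the left end of the edge that receives the
    disagreement, here the edge between \<open>x\<close> and \<open>x + d\<close>.\<close>
  define x' where "x' = (if d = 1 then x else x - 1)"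
  show ?case
  proof (rule law_dominated_tendsto[OF local_fun_cyl[OF assms(1)] local_fun_clash_at law_clash_tendsto])
    fix \<zeta>
    show "cyl W c \<zeta> \<le> real \<theta> * clash_at x' \<zeta>"
    proof (cases "\<forall>x\<in>W. \<zeta> x = c x")
      case True
      hence "\<zeta> x = c x" "\<zeta> (x - d) = c (x - d)" "\<zeta> (x + d) = c (x + d)" using now by auto
      hence "1 \<le> real \<theta> * clash \<zeta> (x - d) x (x + d)"
        using clash_lower_bound[of \<zeta> x "x - d" i "x + d"] now by simp
      also have "clash \<zeta> (x - d) x (x + d) \<le> clash_at x' \<zeta>"
        using now(4) clash_nonneg[of \<zeta> "x - 2" "x - 1" x] clash_nonneg[of \<zeta> "x + 2" "x + 1" x]
        by (auto simp: clash_at_def x'_def add.commute)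
      finally show ?thesis by (simp add: cyl_def mult_left_mono)
    next
      case False
      thus ?thesis using clash_at_nonneg by (auto simp: cyl_def)
    qed
  qed (simp add: cyl_def)
next
  case (step x y c i)
  let ?f = "cyl W (c(x := flip_issue i (c x)))"
  \<comment> \<open>The generator is the inflow into the target state minus an outflow of at most
    \<open>card W\<close> times \<open>?f\<close>. Adding the latter back leaves a function that
    dominates the inflow; its expectation tends to 0 by the induction hypothesis and
    \<open>law_gen_tendsto_zero\<close>.\<close>
  let ?g = "\<lambda>\<zeta>. gen W ?f \<zeta> + real (card W) * ?f \<zeta>"
  note f = local_fun_cyl[OF assms(1)]
  obtain S' B where g: "local_fun S' (gen W ?f)" using gen_local_bounded[OF f] .
  have fin: "finite (W \<union> S')" using assms(1) local_fun_finite[OF g] by simp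
  show ?case
  proof (rule law_dominated_tendsto[OF f])
    show "local_fun (W \<union> S') ?g"
      by (rule local_fun_comp2[OF g f _ fin, where comb = "\<lambda>u v. u + real (card W) * v"]) auto
    have "((\<lambda>t. law t (gen W ?f) + real (card W) * law t ?f) \<longlongrightarrow> 0 + real (card W) * 0) at_top"
      by (intro tendsto_intros law_gen_tendsto_zero[OF f step.IH] step.IH)
    thus "((\<lambda>t. law t ?g) \<longlongrightarrow> 0) at_top"
      using law_add[OF g local_fun_comp[OF f, of "\<lambda>v. real (card W) * v"]] by (simp add: law_cmult)
    fix \<zeta>
    let ?J = "\<lambda>x y. jump \<theta> \<zeta> x y ?f"
    have J: "0 \<le> ?J x y" for x y
      using jump_mono[of \<theta> \<zeta> x y "\<lambda>_. 0" ?f] by (simp add: jump_zero cyl_def)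
    have c: "jump \<theta> \<zeta> x y (\<lambda>_. ?f \<zeta>) \<le> ?f \<zeta> / 2" for x y
      by (simp add: jump_const cyl_def)
    have "?J x y \<le> ?J x (x - 1) + ?J x (x + 1)"
      using step(3) J[of x "x - 1"] J[of x "x + 1"] by auto
    also have "\<dots> \<le> (\<Sum>x\<in>W. ?J x (x - 1) + ?J x (x + 1))"
      using assms(1) step(1) J by (intro member_le_sum) auto
    also have "\<dots> \<le> (\<Sum>x\<in>W. (?J x (x - 1) - jump \<theta> \<zeta> x (x - 1) (\<lambda>_. ?f \<zeta>)) +
        (?J x (x + 1) - jump \<theta> \<zeta> x (x + 1) (\<lambda>_. ?f \<zeta>)) + ?f \<zeta>)"
    proof (rule sum_mono)
      fix x show "?J x (x - 1) + ?J x (x + 1) \<le> (?J x (x - 1) - jump \<theta> \<zeta> x (x - 1) (\<lambda>_. ?f \<zeta>)) +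
        (?J x (x + 1) - jump \<theta> \<zeta> x (x + 1) (\<lambda>_. ?f \<zeta>)) + ?f \<zeta>"
        using c[of x "x - 1"] c[of x "x + 1"] by linarith
    qed
    also have "\<dots> = ?g \<zeta>"
      unfolding deffuant_gen_jump' jump_diff by (simp add: sum.distrib)
    finally have le: "?J x y \<le> ?g \<zeta>" .
    show "cyl W c \<zeta> \<le> (2 * real \<theta>) * ?g \<zeta>"
    proof (cases "\<forall>x\<in>W. \<zeta> x = c x")
      case True
      hence \<zeta>: "\<zeta> x = c x" "\<zeta> y = c y" using step by auto
      have "?f (\<zeta>(x := flip_issue i (\<zeta> x))) \<le> 2 * real \<theta> * ?J x y"
        by (rule jump_single) (use step \<zeta> in \<open>auto simp: cyl_def\<close>)
      also have "\<dots> \<le> 2 * real \<theta> * ?g \<zeta>"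
        by (rule mult_left_mono[OF le]) simp
      also have "?f (\<zeta>(x := flip_issue i (\<zeta> x))) = cyl W c \<zeta>"
        using True \<zeta> by (simp add: cyl_def)
      finally show ?thesis .
    next
      case False
      have "0 \<le> ?g \<zeta>" using le J[of x y] by linarith
      hence "0 \<le> (2 * real \<theta>) * ?g \<zeta>" by simp
      moreover have "cyl W c \<zeta> = 0" using False by (auto simp: cyl_def)
      ultimately show ?thesis by simp
    qed
  qed (simp add: cyl_def)
qed

definition crowded :: "nat \<Rightarrow> (int \<Rightarrow> nat set) \<Rightarrow> bool" where
  "crowded N \<zeta> \<longleftrightarrow> (\<exists>x\<in>{0..<int N}. active \<theta> (\<zeta> x) (\<zeta> (x + 1))) \<and>
     Suc \<theta> < (\<Sum>y\<in>{0..<int N}. hamming (\<zeta> y) (\<zeta> (y + 1)))"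

lemma local_fun_crowded: "local_fun {0..int N} (\<lambda>\<zeta>. of_bool (crowded N \<zeta>))"
proof (rule local_funI)
  fix \<zeta> \<zeta>' :: "int \<Rightarrow> nat set" assume eq: "\<And>x. x \<in> {0..int N} \<Longrightarrow> \<zeta> x = \<zeta>' x"
  have "(\<Sum>y\<in>{0..<int N}. hamming (\<zeta> y) (\<zeta> (y + 1))) = (\<Sum>y\<in>{0..<int N}. hamming (\<zeta>' y) (\<zeta>' (y + 1)))"
    by (intro sum.cong refl) (simp add: eq)
  moreover have "(\<exists>x\<in>{0..<int N}. active \<theta> (\<zeta> x) (\<zeta> (x + 1))) \<longleftrightarrow>
      (\<exists>x\<in>{0..<int N}. active \<theta> (\<zeta>' x) (\<zeta>' (x + 1)))"
    by (intro bex_cong refl) (simp add: eq)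
  ultimately show "of_bool (crowded N \<zeta>) = (of_bool (crowded N \<zeta>') :: real)"
    by (simp add: crowded_def)
qed simp

text \<open>A window has finitely many states, and by \<open>collides_window\<close> each crowded
  one leads to a clash.\<close>

lemma crowded_vanishes: "((\<lambda>t. law t (\<lambda>\<zeta>. of_bool (crowded N \<zeta>))) \<longlongrightarrow> 0) at_top"
proof -
  let ?W = "{0..int N}"
  let ?P = "PiE ?W (\<lambda>_. Pow {..<F})"
  have "law t (\<lambda>\<zeta>. of_bool (crowded N \<zeta>)) = (\<Sum>c\<in>?P. of_bool (crowded N c) * law t (cyl ?W c))" for t
  proof -
    have "law t (\<lambda>\<zeta>. of_bool (crowded N \<zeta>)) = law t (\<lambda>\<zeta>. \<Sum>c\<in>?P. of_bool (crowded N c) * cyl ?W c \<zeta>)"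
      by (rule law_cong, unfold cyl_def, rule local_fun_expand[OF local_fun_crowded])
    also have "\<dots> = (\<Sum>c\<in>?P. law t (\<lambda>\<zeta>. of_bool (crowded N c) * cyl ?W c \<zeta>))"
      by (rule law_sum)
        (rule exI, rule local_fun_comp[where g = "\<lambda>v. _ * v", OF local_fun_cyl], simp)
    finally show ?thesis by (simp add: law_cmult)
  qed
  moreover have "((\<lambda>t. \<Sum>c\<in>?P. of_bool (crowded N c) * law t (cyl ?W c)) \<longlongrightarrow> 0) at_top"
  proof (rule tendsto_null_sum)
    fix c assume c: "c \<in> ?P"
    show "((\<lambda>t. of_bool (crowded N c) * law t (cyl ?W c)) \<longlongrightarrow> 0) at_top"
    proof (cases "crowded N c")
      case True
      then obtain x where x: "0 \<le> x" "x < int N" "active \<theta> (c x) (c (x + 1))"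
        and many: "Suc \<theta> < (\<Sum>y\<in>{0..<int N}. hamming (c y) (c (y + 1)))"
        by (auto simp: crowded_def)
      have "collides \<theta> ?W c"
        by (rule collides_window[OF threshold_pos _ x many])
          (use c issues_eq in \<open>auto simp: PiE_iff Pi_iff\<close>)
      from collides_vanishes[OF _ this] True show ?thesis by simp
    qed simp
  qed
  ultimately show ?thesis by simp
qed

text \<open>In a window of \<open>N\<close> edges that is not crowded at most
  \<open>Suc \<theta>\<close> edges are active, so by translation invariance the density of active
  edges is at most the probability of crowding plus \<open>Suc \<theta> / N\<close>. The window is
  fixed before time goes to infinity.\<close>

theorem active_vanishes: "((\<lambda>t. law t (act_at x)) \<longlongrightarrow> 0) at_top"
proof -
  have "((\<lambda>t. law t (act_at 0)) \<longlongrightarrow> 0) at_top"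
  proof (rule tendstoI)
    fix e :: real assume e: "e > 0"
    obtain N where "real (Suc \<theta>) / (e / 2) < real N" using reals_Archimedean2 by blast
    hence N: "real (Suc \<theta>) < (e / 2) * real N" using e by (simp add: field_simps)
    have N0: "0 < real N" using N e by (cases "N = 0") auto
    have "\<forall>\<^sub>F t in at_top. law t (\<lambda>\<zeta>. of_bool (crowded N \<zeta>)) < e / 2"
      using order_tendstoD(2)[OF crowded_vanishes, of "e / 2"] e by simp
    thus "\<forall>\<^sub>F t in at_top. dist (law t (act_at 0)) 0 < e"
      using eventually_ge_at_top[of 0]
    proof eventually_elim
      case (elim t)
      have loc: "local_fun {0..int N} (\<lambda>\<zeta>. \<Sum>x\<in>{0..<int N}. act_at x \<zeta>)"
        by (intro local_fun_sum local_fun_mono[OF local_fun_act_at]) auto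
      have "real N * law t (act_at 0) = (\<Sum>x\<in>{0..<int N}. law t (act_at 0))"
        by simp
      also have "\<dots> = (\<Sum>x\<in>{0..<int N}. law t (act_at x))"
        by (intro sum.cong refl law_act_at[symmetric] elim(2))
      also have "\<dots> = law t (\<lambda>\<zeta>. \<Sum>x\<in>{0..<int N}. act_at x \<zeta>)"
        by (rule law_sum[symmetric]) (use local_fun_act_at in blast)
      also have "\<dots> \<le> law t (\<lambda>\<zeta>. real N * of_bool (crowded N \<zeta>) + real (Suc \<theta>))"
      proof (rule law_mono[OF loc local_fun_comp[OF local_fun_crowded, where g = "\<lambda>v. real N * v + real (Suc \<theta>)"]])
        fix \<zeta> :: "int \<Rightarrow> nat set"
        show "(\<Sum>x\<in>{0..<int N}. act_at x \<zeta>) \<le> real N * of_bool (crowded N \<zeta>) + real (Suc \<theta>)"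
        proof (cases "crowded N \<zeta>")
          case True
          have "(\<Sum>x\<in>{0..<int N}. act_at x \<zeta>) \<le> (\<Sum>x\<in>{0..<int N}. 1)"
            by (rule sum_mono) (simp add: act_at_def)
          thus ?thesis using True by simp
        next
          case False
          then consider "\<forall>x\<in>{0..<int N}. \<not> active \<theta> (\<zeta> x) (\<zeta> (x + 1))"
            | "(\<Sum>y\<in>{0..<int N}. hamming (\<zeta> y) (\<zeta> (y + 1))) \<le> Suc \<theta>"
            unfolding crowded_def by (meson leI)
          thus ?thesis
          proof cases
            case 1
            hence "(\<Sum>x\<in>{0..<int N}. act_at x \<zeta>) = 0"
              by (intro sum.neutral) (simp add: act_at_def)
            thus ?thesis using False by simp
          next
            case 2
            have "(\<Sum>x\<in>{0..<int N}. act_at x \<zeta>) \<le> (\<Sum>y\<in>{0..<int N}. real (hamming (\<zeta> y) (\<zeta> (y + 1))))"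
              by (rule sum_mono) (auto simp: act_at_def active_def)
            also have "\<dots> \<le> real (Suc \<theta>)"
              using 2 by (simp only: of_nat_sum[symmetric] of_nat_le_iff)
            finally show ?thesis using False by simp
          qed
        qed
      qed
      also have "\<dots> = real N * law t (\<lambda>\<zeta>. of_bool (crowded N \<zeta>)) + real (Suc \<theta>)"
        using law_add[OF local_fun_comp[OF local_fun_crowded, where g = "\<lambda>v. real N * v"], of "{}" "\<lambda>_. real (Suc \<theta>)"]
        by (simp add: law_cmult law_const local_fun_def)
      also have "\<dots> < real N * (e / 2) + (e / 2) * real N"
        using elim(1) N N0 by (intro add_strict_mono mult_strict_left_mono) auto
      finally have "real N * law t (act_at 0) < real N * e" by (simp add: field_simps)
      hence "law t (act_at 0) < e" using N0 by simp
      moreover have "0 \<le> law t (act_at 0)" by (rule law_nonneg) (simp add: act_at_def)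
      ultimately show ?case by simp
    qed
  qed
  moreover have "\<forall>\<^sub>F t in at_top. law t (act_at 0) = law t (act_at x)"
    using eventually_ge_at_top[of 0] by eventually_elim (simp add: law_act_at[of _ x])
  ultimately show ?thesis using tendsto_cong by fastforce
qed

end

section \<open>Full edges disappear\<close>

text \<open>For m ones this is \<open>m \<le> 1 + m * (m - 1) / 2\<close>: if clearly more than one
  event occurs on average, some pair must occur together with noticeable probability.\<close>

lemma sum_le_one_plus_pairs:
  fixes a :: "nat \<Rightarrow> real"
  assumes "\<And>k. a k \<in> {0, 1}"
  shows "(\<Sum>k<N. a k) \<le> 1 + (\<Sum>k<N. \<Sum>j<k. a j * a k)"
proof (induction N)
  case (Suc N)
  have "0 \<le> (\<Sum>k<N. \<Sum>j<k. a j * a k)"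
    using assms by (intro sum_nonneg) (metis insertE insert_absorb insert_not_empty mult_nonneg_nonneg order_refl zero_le_one)
  thus ?case using assms[of N] Suc by auto
qed simp

context deffuant
begin

definition both_full :: "int \<Rightarrow> int \<Rightarrow> (int \<Rightarrow> nat set) \<Rightarrow> real" where
  "both_full x z \<zeta> = full x \<zeta> * full z \<zeta>"

text \<open>A full edge carries an opinion and its complement. Comparing one end
  \<open>\<zeta> z\<close> with both ends of the other edge decides whether the two complementary
  pairs differ.\<close>

definition mixed :: "int \<Rightarrow> int \<Rightarrow> (int \<Rightarrow> nat set) \<Rightarrow> real" where
  "mixed x z \<zeta> = of_bool (hamming (\<zeta> x) (\<zeta> (x + 1)) = F \<and> hamming (\<zeta> z) (\<zeta> (z + 1)) = F \<and>
     \<zeta> z \<noteq> \<zeta> x \<and> \<zeta> z \<noteq> \<zeta> (x + 1))"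

lemma local_fun_both_full: "local_fun {x, x + 1, z, z + 1} (both_full x z)"
  by (simp add: local_fun_def both_full_def full_def)

lemma local_fun_mixed: "local_fun {x, x + 1, z, z + 1} (mixed x z)"
  by (simp add: local_fun_def mixed_def)

lemma config_subset: "\<zeta> \<in> configs F \<Longrightarrow> \<zeta> x \<subseteq> {..<F}"
  by (auto simp: configs_def)

lemma full_complement:
  assumes "\<zeta> \<in> configs F" "hamming (\<zeta> x) (\<zeta> y) = F"
  shows "\<zeta> y = {..<F} - \<zeta> x"
  using full_sym_diff[OF config_subset[OF assms(1)] config_subset[OF assms(1)] assms(2)]
    config_subset[OF assms(1), of x] config_subset[OF assms(1), of y] by blast

text \<open>Without an active edge, each step from \<open>x\<close> to \<open>z\<close> keeps the
  opinion or replaces it by its complement, so only the two opinions of the edge at \<open>x\<close>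
  occur.\<close>

lemma mixed_imp_active:
  assumes \<zeta>: "\<zeta> \<in> configs F" and m: "mixed x z \<zeta> = 1" and xz: "x < z"
  shows "\<exists>y\<in>{x..<z}. active \<theta> (\<zeta> y) (\<zeta> (y + 1))"
proof (rule ccontr)
  assume no: "\<not> ?thesis"
  have m': "hamming (\<zeta> x) (\<zeta> (x + 1)) = F" "\<zeta> z \<noteq> \<zeta> x" "\<zeta> z \<noteq> \<zeta> (x + 1)"
    using m by (auto simp: mixed_def split: if_splits)
  have x1: "\<zeta> (x + 1) = {..<F} - \<zeta> x" by (rule full_complement[OF \<zeta> m'(1)])
  have "y \<le> z \<longrightarrow> \<zeta> y \<in> {\<zeta> x, \<zeta> (x + 1)}" if "x \<le> y" for y
    using that
  proof (induction y rule: int_ge_induct)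
    case (step y)
    show ?case
    proof
      assume y: "y + 1 \<le> z"
      hence IH: "\<zeta> y \<in> {\<zeta> x, \<zeta> (x + 1)}" using step by simp
      have "\<not> active \<theta> (\<zeta> y) (\<zeta> (y + 1))" using no y step by auto
      then consider "\<zeta> y = \<zeta> (y + 1)" | "hamming (\<zeta> y) (\<zeta> (y + 1)) = F"
        using opinion_cases[of "\<zeta> y" \<theta> "\<zeta> (y + 1)"] config_subset[OF \<zeta>] issues_eq by auto
      thus "\<zeta> (y + 1) \<in> {\<zeta> x, \<zeta> (x + 1)}"
      proof cases
        case 2
        from full_complement[OF \<zeta> this] IH x1 config_subset[OF \<zeta>, of x] show ?thesis by auto
      qed (use IH in auto)
    qed
  qed simp
  from this[of z] xz m' show False by auto
qed

lemma mixed_le_active: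
  assumes \<zeta>: "\<zeta> \<in> configs F" and xz: "x < z"
  shows "mixed x z \<zeta> \<le> (\<Sum>y\<in>{x..<z}. act_at y \<zeta>)"
proof (cases "mixed x z \<zeta> = 1")
  case True
  then obtain y where y: "y \<in> {x..<z}" "active \<theta> (\<zeta> y) (\<zeta> (y + 1))"
    using mixed_imp_active[OF \<zeta> _ xz] by blast
  have "1 = act_at y \<zeta>" using y by (simp add: act_at_def)
  also have "\<dots> \<le> (\<Sum>y\<in>{x..<z}. act_at y \<zeta>)"
    by (rule member_le_sum) (use y in \<open>auto simp: act_at_def\<close>)
  finally show ?thesis using True by simp
next
  case False
  hence "mixed x z \<zeta> = 0" by (simp add: mixed_def)
  thus ?thesis by (simp add: act_at_def sum_nonneg)
qed

lemma mixed_vanishes: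
  assumes "x < z"
  shows "((\<lambda>t. law t (mixed x z)) \<longlongrightarrow> 0) at_top"
proof (rule law_dominated_tendsto[OF local_fun_mixed])
  show "local_fun {x..z} (\<lambda>\<zeta>. \<Sum>y\<in>{x..<z}. act_at y \<zeta>)"
    by (intro local_fun_sum local_fun_mono[OF local_fun_act_at]) auto
  have "law t (\<lambda>\<zeta>. \<Sum>y\<in>{x..<z}. act_at y \<zeta>) = (\<Sum>y\<in>{x..<z}. law t (act_at y))" for t
    by (rule law_sum) (use local_fun_act_at in blast)
  thus "((\<lambda>t. law t (\<lambda>\<zeta>. \<Sum>y\<in>{x..<z}. act_at y \<zeta>)) \<longlongrightarrow> 0) at_top"
    using tendsto_null_sum[OF active_vanishes] by simp
  show "mixed x z \<zeta> \<le> 1 * (\<Sum>y\<in>{x..<z}. act_at y \<zeta>)" if "\<zeta> \<in> configs F" for \<zeta>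
    using mixed_le_active[OF that assms] by simp
qed (simp add: mixed_def)

text \<open>Any disagreement that hops onto a full edge meets one on the same issue, so the clash
  ratio is 1.\<close>

lemma clash_full:
  assumes \<zeta>: "\<zeta> \<in> configs F" and full: "hamming (\<zeta> x) (\<zeta> z) = F"
  shows "clash \<zeta> y x z = of_bool (active \<theta> (\<zeta> x) (\<zeta> y))"
proof -
  have "sym_diff (\<zeta> x) (\<zeta> y) \<inter> sym_diff (\<zeta> x) (\<zeta> z) = sym_diff (\<zeta> x) (\<zeta> y)"
    using full_sym_diff[OF config_subset[OF \<zeta>] config_subset[OF \<zeta>] full] configs_sym_diff[OF \<zeta>]
    by (intro Int_absorb2) simp
  thus ?thesis by (simp add: clash_def) (auto simp: hamming_def active_def)
qed

lemma full_not_active: "hamming u v = F \<Longrightarrow> \<not> active \<theta> u v"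
  using issues_eq by (simp add: active_def)

text \<open>A full edge can only be dissolved by a clash.\<close>

lemma gen_mixed:
  assumes \<zeta>: "\<zeta> \<in> configs F" and xz: "x + 1 < z"
  shows "- (clash_at x \<zeta> + clash_at z \<zeta>) \<le> gen {x, x + 1, z, z + 1} (mixed x z) \<zeta>"
proof -
  let ?m = "mixed x z"
  let ?J = "\<lambda>u v. jump \<theta> \<zeta> u v (\<lambda>\<xi>. ?m \<xi> - ?m \<zeta>)"
  have gen: "gen {x, x + 1, z, z + 1} ?m \<zeta> = ?J x (x - 1) + ?J x (x + 1) + (?J (x + 1) x + ?J (x + 1) (x + 2))
      + (?J z (z - 1) + ?J z (z + 1)) + (?J (z + 1) z + ?J (z + 1) (z + 2))"
    unfolding deffuant_gen_jump' using xz by (simp add: ac_simps)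
  consider "?m \<zeta> = 0" | "?m \<zeta> = 1" by (auto simp: mixed_def)
  thus ?thesis
  proof cases
    case 1
    have pos: "0 \<le> ?m \<xi>" for \<xi> by (simp add: mixed_def)
    have "jump \<theta> \<zeta> u v (\<lambda>_. 0) \<le> ?J u v" for u v
      by (rule jump_mono) (simp add: 1 pos)
    hence "0 \<le> ?J u v" for u v by (simp only: jump_zero)
    note this[of x "x - 1"] this[of x "x + 1"] this[of "x + 1" x] this[of "x + 1" "x + 2"]
      this[of z "z - 1"] this[of z "z + 1"] this[of "z + 1" z] this[of "z + 1" "z + 2"]
    thus ?thesis
      unfolding gen using clash_at_nonneg[of x \<zeta>] clash_at_nonneg[of z \<zeta>] by linarith
  next
    case 2
    \<comment> \<open>Each jump lowers the indicator by at most 1, and the rate 1/2 is given away.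
      Jumps across the two full edges do not occur; the four others hop onto a full edge and are
      counted by \<open>clash_at\<close>.\<close>
    have J: "- of_bool (active \<theta> (\<zeta> u) (\<zeta> v)) \<le> ?J u v" for u v
    proof -
      have "jump \<theta> \<zeta> u v (\<lambda>_. - 1) \<le> ?J u v"
        by (rule jump_mono) (simp add: 2, simp add: mixed_def)
      thus ?thesis by (simp add: jump_const split: if_splits)
    qed
    have full: "hamming (\<zeta> x) (\<zeta> (x + 1)) = F" "hamming (\<zeta> (x + 1)) (\<zeta> x) = F"
      "hamming (\<zeta> z) (\<zeta> (z + 1)) = F" "hamming (\<zeta> (z + 1)) (\<zeta> z) = F"
      using 2 by (auto simp: mixed_def hamming_commute split: if_splits)
    show ?thesis
      using J[of x "x - 1"] J[of x "x + 1"] J[of "x + 1" x] J[of "x + 1" "x + 2"]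
        J[of z "z - 1"] J[of z "z + 1"] J[of "z + 1" z] J[of "z + 1" "z + 2"]
      unfolding gen clash_at_def clash_full[OF \<zeta> full(1)] clash_full[OF \<zeta> full(2)]
        clash_full[OF \<zeta> full(3)] clash_full[OF \<zeta> full(4)]
      by (simp add: full_not_active[OF full(1)] full_not_active[OF full(2)]
        full_not_active[OF full(3)] full_not_active[OF full(4)])
  qed
qed

text \<open>The mixed probability falls no faster than twice the clash rate, while the density of
  disagreements falls exactly at the clash rate, so the combination \<open>?f\<close> never
  decreases; at infinity the mixed term is gone and only \<open>- 2 * disagree_limit\<close>
  remains.\<close>

lemma law_mixed_le:
  assumes xz: "x + 1 < z" and s: "0 < s"
  shows "law s (mixed x z) \<le> 2 * (law s (disagree 0) - disagree_limit)"
proof -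
  let ?f = "\<lambda>t. law t (mixed x z) - 2 * law t (disagree 0)"
  have "?f s \<le> ?f t" if "s \<le> t" for t
  proof (rule DERIV_nonneg_imp_nondecreasing[OF that])
    fix r assume "s \<le> r" "r \<le> t"
    hence r: "0 < r" using s by simp
    note loc = local_fun_clash_at[of x] local_fun_clash_at[of z]
    let ?S = "{x, x + 1, z, z + 1}"
    obtain S' B where g: "local_fun S' (gen ?S (mixed x z))" using gen_local_bounded[OF local_fun_mixed] .
    have "law r (\<lambda>\<zeta>. - (clash_at x \<zeta> + clash_at z \<zeta>)) \<le> law r (gen ?S (mixed x z))"
      by (rule law_mono[OF local_fun_comp2[OF loc order_refl] g]) (use gen_mixed[OF _ xz] in auto)
    hence "- 2 * law r (clash_at 0) \<le> law r (gen ?S (mixed x z))"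
      unfolding law_minus law_add[OF loc] using law_clash_at[of r x] law_clash_at[of r z] r by simp
    moreover have "(?f has_real_derivative law r (gen ?S (mixed x z)) - 2 * - law r (clash_at 0)) (at r)"
      using law_has_derivative[OF local_fun_mixed, of r x z] law_disagree_derivative[of r] r
      by (intro DERIV_diff DERIV_cmult) (simp_all add: at_within_pos)
    ultimately show "\<exists>y. (?f has_real_derivative y) (at r) \<and> 0 \<le> y"
      by (intro exI[of _ "law r (gen ?S (mixed x z)) - 2 * - law r (clash_at 0)"]) simp
  qed
  hence "\<forall>\<^sub>F t in at_top. ?f s \<le> ?f t"
    unfolding eventually_at_top_linorder by blast
  moreover have "(?f \<longlongrightarrow> 0 - 2 * disagree_limit) at_top"
    using xz by (intro tendsto_intros mixed_vanishes law_disagree_tendsto) simp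
  ultimately have "?f s \<le> 0 - 2 * disagree_limit"
    by (intro tendsto_lowerbound[of ?f]) auto
  thus ?thesis by simp
qed

text \<open>If both full edges carry the same pair, flipping issue 0 at \<open>z\<close> and
  \<open>z + 1\<close> keeps that edge full but changes its pair: as \<open>F\<close> is at least 2,
  a single flip leads neither to the same opinion nor to the complement.\<close>

lemma both_full_le:
  assumes \<zeta>: "\<zeta> \<in> configs F" and n: "x + 1 \<le> n" "n < z"
  shows "both_full x z \<zeta> \<le> mixed x z \<zeta> + mixed x z (flip_right n \<zeta>)"
proof (cases "both_full x z \<zeta> = 1 \<and> mixed x z \<zeta> = 0")
  case True
  hence full: "hamming (\<zeta> x) (\<zeta> (x + 1)) = F" "hamming (\<zeta> z) (\<zeta> (z + 1)) = F"
    and z: "\<zeta> z = \<zeta> x \<or> \<zeta> z = \<zeta> (x + 1)"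
    by (auto simp: both_full_def full_def mixed_def simp flip: of_bool_conj)
  have "(0 \<in> flip_issue 0 u) \<noteq> (0 \<in> u)" for u by (simp add: flip_issue_def)
  hence ne: "flip_issue 0 u \<noteq> u" for u by metis
  have "sym_diff u (flip_issue 0 u) = {0}" for u by (auto simp: flip_issue_def)
  hence one: "hamming u (flip_issue 0 u) \<noteq> F" for u
    using threshold_pos issues_eq by (simp add: hamming_def)
  have "flip_issue 0 (\<zeta> z) \<noteq> \<zeta> x" "flip_issue 0 (\<zeta> z) \<noteq> \<zeta> (x + 1)"
    using z ne one full hamming_commute by metis+
  hence "mixed x z (flip_right n \<zeta>) = 1"
    using n full by (simp add: mixed_def flip_right_def hamming_flip_issue)
  thus ?thesis using True by simp
next
  case False
  moreover have "both_full x z \<zeta> \<in> {0, 1}" "mixed x z \<xi> \<in> {0, 1}" for \<xi>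
    unfolding both_full_def full_def mixed_def of_bool_conj[symmetric] of_bool_def by simp_all
  note this(1) this(2)[of \<zeta>] this(2)[of "flip_right n \<zeta>"]
  ultimately show ?thesis by auto
qed

text \<open>Both mixed probabilities are controlled by \<open>law_mixed_le\<close>, the flipped one
  up to the error \<open>\<epsilon>\<close> of \<open>law_flip_right\<close>.\<close>

lemma law_both_full_le:
  assumes s: "0 < s" and \<epsilon>: "0 < \<epsilon>"
  obtains m where "0 < m"
    "\<And>x z. x + int m \<le> z \<Longrightarrow> law s (both_full x z) \<le> 4 * (law s (disagree 0) - disagree_limit) + \<epsilon>"
proof -
  obtain m where m: "\<And>x z n h. x + int m \<le> n \<Longrightarrow> n + int m \<le> z \<Longrightarrow>
      local_fun {x, x + 1, z, z + 1} h \<Longrightarrow> (\<And>\<zeta>. \<bar>h \<zeta>\<bar> \<le> 1) \<Longrightarrow>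
      \<bar>law s (h \<circ> flip_right n) - law s h\<bar> \<le> \<epsilon>"
    using law_flip_right[OF less_imp_le[OF s] \<epsilon>] by metis
  show thesis
  \<comment> \<open>Room for a cut \<open>n\<close> at distance at least \<open>m\<close> from both
    \<open>x\<close> and \<open>z\<close>.\<close>
  proof (rule that[of "2 * m + 2"])
    fix x z :: int assume xz: "x + int (2 * m + 2) \<le> z"
    define n where "n = x + int m + 1"
    note l = local_fun_mixed[of x z] local_fun_flip_right[OF local_fun_mixed, of x z n]
    have "law s (both_full x z) \<le> law s (\<lambda>\<zeta>. mixed x z \<zeta> + (mixed x z \<circ> flip_right n) \<zeta>)"
      by (rule law_mono[OF local_fun_both_full local_fun_comp2[OF l order_refl]])
        (use xz in \<open>auto simp: n_def intro!: both_full_le\<close>)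
    also have "\<dots> = law s (mixed x z) + law s (mixed x z \<circ> flip_right n)"
      by (rule law_add[OF l])
    also have "law s (mixed x z \<circ> flip_right n) \<le> law s (mixed x z) + \<epsilon>"
      using m[OF _ _ l(1), of n] xz by (simp add: n_def mixed_def abs_le_iff)
    also have "law s (mixed x z) \<le> 2 * (law s (disagree 0) - disagree_limit)"
      by (rule law_mixed_le[OF _ s]) (use xz in simp)
    finally show "law s (both_full x z) \<le> 4 * (law s (disagree 0) - disagree_limit) + \<epsilon>"
      by simp
  qed simp
qed

lemma disagree_le_full:
  assumes "0 \<le> t"
  shows "law t (disagree 0) \<le> real F * (law t (full 0) + law t (act_at 0))"
proof -
  note l = local_fun_full[of 0] local_fun_act_at[of 0]
  have loc: "local_fun {0, 0 + 1} (\<lambda>\<zeta>. real F * (full 0 \<zeta> + act_at 0 \<zeta>))"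
    by (rule local_fun_comp2[OF l, where comb = "\<lambda>u v. real F * (u + v)"]) auto
  have "law t (disagree 0) \<le> law t (\<lambda>\<zeta>. real F * (full 0 \<zeta> + act_at 0 \<zeta>))"
  proof (rule law_mono[OF local_fun_disagree loc])
    fix \<zeta> assume \<zeta>: "\<zeta> \<in> configs F"
    have le: "real (hamming (\<zeta> 0) (\<zeta> 1)) \<le> real F"
      using hamming_le[OF config_subset[OF \<zeta>] config_subset[OF \<zeta>]] by simp
    consider "\<zeta> 0 = \<zeta> 1" | "active \<theta> (\<zeta> 0) (\<zeta> 1)" | "hamming (\<zeta> 0) (\<zeta> 1) = F"
      using opinion_cases[of "\<zeta> 0" \<theta> "\<zeta> 1"] config_subset[OF \<zeta>] issues_eq by auto
    thus "disagree 0 \<zeta> \<le> real F * (full 0 \<zeta> + act_at 0 \<zeta>)"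
      by cases (use le in \<open>auto simp: disagree_def full_def act_at_def\<close>)
  qed
  also have "\<dots> = real F * (law t (full 0) + law t (act_at 0))"
    by (simp add: law_cmult law_add[OF l])
  finally show ?thesis .
qed

text \<open>A positive limit keeps the density of full edges above \<open>p\<close>. Among
  \<open>N\<close> edges placed far apart more than 2 would be full on average, yet near the limit
  hardly any pair is full together, which \<open>sum_le_one_plus_pairs\<close> turns into a mean of
  at most 1 + 5/8.\<close>

lemma disagree_limit_zero: "disagree_limit = 0"
proof (rule ccontr)
  assume "disagree_limit \<noteq> 0"
  moreover have "0 \<le> disagree_limit"
    unfolding disagree_limit_def by (rule cINF_greatest) (auto intro: law_disagree_nonneg)
  ultimately have l: "0 < disagree_limit" by simp
  have F: "0 < real F" using issues_eq by simp
  \<comment> \<open>The limit equals \<open>2 * real F * p\<close>; by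
    \<open>disagree_le_full\<close> more than \<open>p\<close> is left for full edges once the
    active ones are below \<open>p\<close>.\<close>
  define p where "p = disagree_limit / (2 * real F)"
  have p: "0 < p" using l F by (simp add: p_def)
  obtain N where "2 / p < real N" using reals_Archimedean2 by blast
  hence N: "2 < real N * p" using p by (simp add: field_simps)
  have N0: "0 < real N" using N by (cases "N = 0") auto
  \<comment> \<open>At most \<open>N * N\<close> pairs, each of probability at most
    \<open>5 * \<epsilon>\<close>, contribute at most 5/8; the 5 is made up of 4 from the distance
    to the limit and 1 from the flip.\<close>
  define \<epsilon> where "\<epsilon> = 1 / (8 * (real N)\<^sup>2)"
  have \<epsilon>: "0 < \<epsilon>" using N0 by (simp add: \<epsilon>_def)
  have "\<forall>\<^sub>F t in at_top. law t (act_at 0) < p"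
    using order_tendstoD(2)[OF active_vanishes p] .
  moreover have "\<forall>\<^sub>F t in at_top. law t (disagree 0) < disagree_limit + \<epsilon>"
    using order_tendstoD(2)[OF law_disagree_tendsto, of "disagree_limit + \<epsilon>"] \<epsilon> by simp
  ultimately have "\<forall>\<^sub>F t in at_top. law t (act_at 0) < p \<and> law t (disagree 0) < disagree_limit + \<epsilon> \<and> 0 < t"
    using eventually_gt_at_top[of 0] by eventually_elim simp
  then obtain t where act: "law t (act_at 0) < p" and dis: "law t (disagree 0) < disagree_limit + \<epsilon>"
    and t: "0 < t"
    unfolding eventually_at_top_linorder by blast
  have "2 * real F * p \<le> real F * (law t (full 0) + law t (act_at 0))"
    using disagree_limit_le[OF t] disagree_le_full[of t] t F by (simp add: p_def)
  hence "2 * p \<le> law t (full 0) + law t (act_at 0)"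
    using F by (simp add: mult.commute mult.left_commute)
  hence full: "p < law t (full 0)" using act by simp
  obtain m where m: "0 < m" "\<And>x z. x + int m \<le> z \<Longrightarrow>
      law t (both_full x z) \<le> 4 * (law t (disagree 0) - disagree_limit) + \<epsilon>"
    using law_both_full_le[OF t \<epsilon>] by metis
  define X where "X k = int (k * m)" for k
  have pair: "law t (both_full (X j) (X k)) \<le> 5 * \<epsilon>" if "j < k" for j k
  proof -
    have "(j + 1) * m \<le> k * m" using that by (intro mult_le_mono1) simp
    hence "X j + int m \<le> X k"
      unfolding X_def of_nat_add[symmetric] of_nat_le_iff by simp
    from m(2)[OF this] dis show ?thesis by simp
  qed
  let ?f = "\<lambda>\<zeta>. \<Sum>k<N. full (X k) \<zeta>" and ?g = "\<lambda>\<zeta>. \<Sum>k<N. \<Sum>j<k. both_full (X j) (X k) \<zeta>"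
  let ?W = "{0..X N + 1}"
  have X: "0 \<le> X k" "k < N \<Longrightarrow> X k \<le> X N" for k
    by (simp_all add: X_def mult_right_mono)
  have f: "local_fun ?W ?f"
    by (intro local_fun_sum local_fun_mono[OF local_fun_full]) (use X in force)+
  have g1: "local_fun ?W (\<lambda>\<zeta>. \<Sum>j<k. both_full (X j) (X k) \<zeta>)" if "k < N" for k
  proof (intro local_fun_sum local_fun_mono[OF local_fun_both_full])
    fix j assume "j \<in> {..<k}"
    hence "X j \<le> X N" "X k \<le> X N" using X(2) that by auto
    thus "{X j, X j + 1, X k, X k + 1} \<subseteq> ?W" using X(1)[of j] X(1)[of k] by auto
  qed auto
  have g: "local_fun ?W ?g"
    by (intro local_fun_sum g1) auto
  have "real N * p \<le> (\<Sum>k<N. law t (full (X k)))"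
    using full t by (intro sum_bounded_below[of "{..<N}" p, simplified]) (simp add: law_full[of t "X _"])
  also have "\<dots> = law t ?f"
    by (rule law_sum[symmetric]) (use local_fun_full in blast)
  also have "\<dots> \<le> law t (\<lambda>\<zeta>. 1 + ?g \<zeta>)"
    by (rule law_mono[OF f local_fun_comp[OF g]])
      (unfold both_full_def, rule sum_le_one_plus_pairs, simp add: full_def)
  also have "\<dots> = 1 + law t ?g"
    using law_add[of "{}" "\<lambda>_. 1" ?W ?g] g by (simp add: law_const local_fun_def)
  also have "law t ?g = (\<Sum>k<N. \<Sum>j<k. law t (both_full (X j) (X k)))"
    by (subst law_sum) (use g1 local_fun_both_full in \<open>auto intro!: sum.cong law_sum\<close>)
  also have "\<dots> \<le> (\<Sum>k<N. \<Sum>j<N. 5 * \<epsilon>)"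
  proof (rule sum_mono)
    fix k assume k: "k \<in> {..<N}"
    have "(\<Sum>j<k. law t (both_full (X j) (X k))) \<le> (\<Sum>j<k. 5 * \<epsilon>)"
      by (rule sum_mono) (simp add: pair)
    also have "\<dots> \<le> (\<Sum>j<N. 5 * \<epsilon>)"
      using k \<epsilon> by (intro sum_mono2) auto
    finally show "(\<Sum>j<k. law t (both_full (X j) (X k))) \<le> (\<Sum>j<N. 5 * \<epsilon>)" .
  qed
  also have "\<dots> = 5 / 8" using N0 by (simp add: \<epsilon>_def power2_eq_square)
  finally show False using N by simp
qed

text \<open>Different opinions at \<open>x\<close> and \<open>y\<close> force a disagreeing edge
  between them, so a union bound reduces the claim to the vanishing density of
  disagreements.\<close>

lemma law_neq_vanishes:
  assumes "x \<le> y"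
  shows "((\<lambda>t. law t (\<lambda>\<zeta>. of_bool (\<zeta> x \<noteq> \<zeta> y))) \<longlongrightarrow> 0) at_top"
proof (rule law_dominated_tendsto)
  show "local_fun {x, y} (\<lambda>\<zeta>. of_bool (\<zeta> x \<noteq> \<zeta> y))" by (simp add: local_fun_def)
  show "local_fun {x..y} (\<lambda>\<zeta>. \<Sum>k\<in>{x..<y}. disagree k \<zeta>)"
    by (intro local_fun_sum local_fun_mono[OF local_fun_disagree]) auto
  have "((\<lambda>t. law t (disagree k)) \<longlongrightarrow> 0) at_top" for k
  proof -
    have "\<forall>\<^sub>F t in at_top. law t (disagree 0) = law t (disagree k)"
      using eventually_ge_at_top[of 0] by eventually_elim (simp add: law_disagree[of _ k])
    with law_disagree_tendsto show ?thesis
      unfolding disagree_limit_zero using tendsto_cong by fastforce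
  qed
  moreover have "law t (\<lambda>\<zeta>. \<Sum>k\<in>{x..<y}. disagree k \<zeta>) = (\<Sum>k\<in>{x..<y}. law t (disagree k))" for t
    by (rule law_sum) (use local_fun_disagree in blast)
  ultimately show "((\<lambda>t. law t (\<lambda>\<zeta>. \<Sum>k\<in>{x..<y}. disagree k \<zeta>)) \<longlongrightarrow> 0) at_top"
    using tendsto_null_sum[of "{x..<y}" "\<lambda>t k. law t (disagree k)"] by simp
  fix \<zeta> assume \<zeta>: "\<zeta> \<in> configs F"
  show "of_bool (\<zeta> x \<noteq> \<zeta> y) \<le> 1 * (\<Sum>k\<in>{x..<y}. disagree k \<zeta>)"
  proof (cases "\<exists>k\<in>{x..<y}. hamming (\<zeta> k) (\<zeta> (k + 1)) \<noteq> 0")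
    case True
    then obtain k where k: "k \<in> {x..<y}" "1 \<le> disagree k \<zeta>"
      by (auto simp: disagree_def Suc_le_eq)
    note k(2)
    also have "disagree k \<zeta> \<le> (\<Sum>k\<in>{x..<y}. disagree k \<zeta>)"
      by (rule member_le_sum) (use k in \<open>auto simp: disagree_def\<close>)
    finally show ?thesis by simp
  next
    case False
    have "z \<le> y \<longrightarrow> \<zeta> z = \<zeta> x" if "x \<le> z" for z
      using that
    proof (induction z rule: int_ge_induct)
      case (step z)
      show ?case
      proof
        assume z: "z + 1 \<le> y"
        have "hamming (\<zeta> z) (\<zeta> (z + 1)) = 0" using False z step(1) by simp
        moreover have "\<zeta> z = \<zeta> x" using z step by simp
        ultimately show "\<zeta> (z + 1) = \<zeta> x"
          using hamming_eq_0[OF config_subset[OF \<zeta>] config_subset[OF \<zeta>]] by metis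
      qed
    qed simp
    from this[of y] assms have "\<zeta> x = \<zeta> y" by simp
    thus ?thesis by (simp add: disagree_def sum_nonneg)
  qed
qed simp

lemma clustering: "((\<lambda>t. measure M {\<omega>\<in>space M. \<eta> t x \<omega> = \<eta> t y \<omega>}) \<longlongrightarrow> 1) at_top"
proof -
  have *: "((\<lambda>t. law t (\<lambda>\<zeta>. of_bool (\<zeta> x \<noteq> \<zeta> y))) \<longlongrightarrow> 0) at_top"
    using law_neq_vanishes[of x y] law_neq_vanishes[of y x]
    by (cases "x \<le> y") (simp_all add: eq_commute)
  have loc: "local_fun {x, y} (\<lambda>\<zeta>. of_bool (\<zeta> x \<noteq> \<zeta> y) :: real)" by (simp add: local_fun_def)
  have "measure M {\<omega>\<in>space M. \<eta> t x \<omega> = \<eta> t y \<omega>} = 1 - law t (\<lambda>\<zeta>. of_bool (\<zeta> x \<noteq> \<zeta> y))" for t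
  proof -
    let ?A = "{\<omega>\<in>space M. \<eta> t x \<omega> = \<eta> t y \<omega>}"
    have "?A = (\<lambda>\<omega>. of_bool (conf t \<omega> x \<noteq> conf t \<omega> y) :: real) -` {0} \<inter> space M"
      by (auto simp: conf_def)
    hence "?A \<in> sets M"
      using measurable_sets[OF measurable_local[OF loc, of t], of "{0}"] by simp
    hence "measure M ?A = (\<integral>\<omega>. indicator ?A \<omega> \<partial>M)" by simp
    also have "\<dots> = (\<integral>\<omega>. 1 - of_bool (conf t \<omega> x \<noteq> conf t \<omega> y) \<partial>M)"
      by (rule Bochner_Integration.integral_cong) (auto simp: conf_def)
    also have "\<dots> = 1 - law t (\<lambda>\<zeta>. of_bool (\<zeta> x \<noteq> \<zeta> y))"
      using integrable_local[OF loc, of t] by (simp add: law_def prob_space)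
    finally show ?thesis .
  qed
  thus ?thesis using tendsto_diff[OF tendsto_const[of 1] *] by simp
qed

end

theorem theorem1:
  fixes F \<theta> :: nat and M :: "'a measure" and \<eta> :: "real \<Rightarrow> int \<Rightarrow> 'a \<Rightarrow> nat set"
  assumes "\<theta> \<ge> 1" and "F = \<theta> + 1"
    and "deffuant_process F \<theta> M \<eta>"
    and "uniform_product_init F M \<eta>"
  shows "\<forall>x y. ((\<lambda>t. measure M {\<omega>\<in>space M. \<eta> t x \<omega> = \<eta> t y \<omega>}) \<longlongrightarrow> 1) at_top"
proof -
  interpret deffuant F \<theta> M \<eta> by unfold_locales fact+
  show ?thesis using clustering by blast
qed

end
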